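(* Let $L$ be a Lie conformal superalgebra with $Z(L)=0$ and let $A$ be a finite-dimensional associative commutative algebra with unity. Suppose every super-biderivation $\psi_\lambda$ of $L$ is of the form $\psi_\lambda(x,y)=\alpha_\mu([x_\lambda y])$ for some $\alpha\in\mathrm{Cent}(L)$. Then every super-biderivation $\varphi_\lambda$ of the current Lie conformal superalgebra $L\otimes A$ is of the same form: there exists $\epsilon\in\mathrm{Cent}(L\otimes A)$ such that $$\varphi_\lambda(x\otimes a,y\otimes b)=(-1)^{|\varphi|(|x|+|y|)}\epsilon_\mu([x_\lambda y]\otimes ab)$$ for all homogeneous $x,y\in L$, $a,b\in A$.
   Context: A Lie conformal superalgebra is a $\mathbb{Z}_2$-graded $\mathbb{C}[\partial]$-module with a $\mathbb{C}$-linear $\lambda$-bracket into $\mathbb{C}[\lambda]\otimes L$ satisfying $[\partial x_\lambda y]=-\lambda[x_\lambda y]$, $[x_\lambda\partial y]=(\partial+\lambda)[x_\lambda y]$, $[x_\lambda y]=-(-1)^{|x||y|}[y_{-\lambda-\partial}x]$, $[x_\lambda[y_\mu z]]=[[x_\lambda y]_{\lambda+\mu}z]+(-1)^{|x||y|}[y_\mu[x_\lambda z]]$. $Z(L)=\{x:[x_\lambda y]=0\ \forall y\in L\}$. The current Lie conformal superalgebra $L\otimes A$ has grading and $\partial$ from $L$ and bracket $[(x\otimes a)_\lambda(y\otimes b)]=[x_\lambda y]\otimes ab$. A (skew-symmetric) super-biderivation of a Lie conformal superalgebra $\mathcal{L}$ is a conformal bilinear map $\varphi_\lambda:\mathcal{L}\times\mathcal{L}\to\mathbb{C}[\lambda]\otimes\mathcal{L}$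 of degree $|\varphi|$ with $\varphi_\lambda(x,y)=-(-1)^{|x||y|}\varphi_{-\partial-\lambda}(y,x)$ and $\varphi_\lambda(x,[y_\mu z])=[\varphi_\lambda(x,y)_{\lambda+\mu}z]+(-1)^{|x||y|}[y_\mu\varphi_\lambda(x,z)]$. The centroid $\mathrm{Cent}(\mathcal L)$ consists of linear maps $\alpha_\lambda:\mathcal L\to\mathbb{C}[\lambda]\otimes\mathcal L$ of degree $|\alpha|$ with $\alpha_\lambda([x_\mu y])=(-1)^{|x||\alpha|}[x_\mu\alpha_\lambda(y)]=[\alpha_\lambda(x)_\mu y]$. *)

theory Defs
  imports "HOL-Computational_Algebra.Polynomial" "HOL-Library.Function_Algebras"
begin

text \<open>A (Z2-graded) Lie conformal superalgebra over the complex numbers.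
  The underlying complex vector space is a type with an additive group
  structure together with an explicit scalar multiplication; the lambda-bracket
  takes values in C[lambda] (x) L, represented as polynomials with coefficients
  in L.  Polynomial identities in one or two indeterminates (lambda, mu) are
  stated by evaluating the indeterminates at arbitrary complex numbers c, d.\<close>

declare [[typedef_overloaded]]

record 'a lcs =
  scal :: "complex \<Rightarrow> 'a \<Rightarrow> 'a"
  der :: "'a \<Rightarrow> 'a"
  ev_part :: "'a set"
  od_part :: "'a set"
  lbr :: "'a \<Rightarrow> 'a \<Rightarrow> 'a poly"

definition cvs :: "(complex \<Rightarrow> 'a::ab_group_add \<Rightarrow> 'a) \<Rightarrow> bool" where
  "cvs s \<longleftrightarrow> (\<forall>x. s 1 x = x) \<and> (\<forall>a b x. s (a * b) x = s a (s b x))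
     \<and> (\<forall>a b x. s (a + b) x = s a x + s b x) \<and> (\<forall>a x y. s a (x + y) = s a x + s a y)"

definition lin :: "(complex \<Rightarrow> 'a::plus \<Rightarrow> 'a) \<Rightarrow> (complex \<Rightarrow> 'b::plus \<Rightarrow> 'b) \<Rightarrow> ('a \<Rightarrow> 'b) \<Rightarrow> bool" where
  "lin s t f \<longleftrightarrow> (\<forall>x y. f (x + y) = f x + f y) \<and> (\<forall>a x. f (s a x) = t a (f x))"

definition subsp :: "(complex \<Rightarrow> 'a::ab_group_add \<Rightarrow> 'a) \<Rightarrow> 'a set \<Rightarrow> bool" where
  "subsp s V \<longleftrightarrow> 0 \<in> V \<and> (\<forall>x\<in>V. \<forall>y\<in>V. x + y \<in> V) \<and> (\<forall>a. \<forall>x\<in>V. s a x \<in> V)"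

definition homog :: "('a, 'b) lcs_scheme \<Rightarrow> nat \<Rightarrow> 'a \<Rightarrow> bool" where
  "homog L i x \<longleftrightarrow> (i = 0 \<and> x \<in> ev_part L) \<or> (i = 1 \<and> x \<in> od_part L)"

definition psign :: "nat \<Rightarrow> 'a::ab_group_add \<Rightarrow> 'a" where
  "psign k v = (if even k then v else - v)"

definition pscal :: "('a::zero, 'b) lcs_scheme \<Rightarrow> complex \<Rightarrow> 'a poly \<Rightarrow> 'a poly" where
  "pscal L a p = map_poly (scal L a) p"

definition pev :: "('a::comm_monoid_add, 'b) lcs_scheme \<Rightarrow> 'a poly \<Rightarrow> complex \<Rightarrow> 'a" where
  "pev L p c = (\<Sum>n\<le>degree p. scal L (c ^ n) (coeff p n))"

text \<open>substitution lambda := -c - \<partial>, i.e. evaluation of p at -lambda-\<partial> with lambda = c\<close>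
definition pev_skew :: "('a::ab_group_add, 'b) lcs_scheme \<Rightarrow> 'a poly \<Rightarrow> complex \<Rightarrow> 'a" where
  "pev_skew L p c = (\<Sum>n\<le>degree p. ((\<lambda>v. scal L (- c) v - der L v) ^^ n) (coeff p n))"

definition is_LCSA :: "('a::ab_group_add, 'b) lcs_scheme \<Rightarrow> bool" where
  "is_LCSA L \<longleftrightarrow> cvs (scal L)
    \<and> subsp (scal L) (ev_part L) \<and> subsp (scal L) (od_part L)
    \<and> ev_part L \<inter> od_part L = {0} \<and> (\<forall>x. \<exists>u\<in>ev_part L. \<exists>v\<in>od_part L. x = u + v)
    \<and> lin (scal L) (scal L) (der L)
    \<and> der L ` ev_part L \<subseteq> ev_part L \<and> der L ` od_part L \<subseteq> od_part L
    \<and> (\<forall>y. lin (scal L) (pscal L) (\<lambda>x. lbr L x y))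
    \<and> (\<forall>x. lin (scal L) (pscal L) (lbr L x))
    \<and> (\<forall>i j x y. homog L i x \<longrightarrow> homog L j y \<longrightarrow>
          (\<forall>n. homog L ((i + j) mod 2) (coeff (lbr L x y) n)))
    \<and> (\<forall>x y c. pev L (lbr L (der L x) y) c = scal L (- c) (pev L (lbr L x y) c))
    \<and> (\<forall>x y c. pev L (lbr L x (der L y)) c
                = der L (pev L (lbr L x y) c) + scal L c (pev L (lbr L x y) c))
    \<and> (\<forall>i j x y c. homog L i x \<longrightarrow> homog L j y \<longrightarrow>
          pev L (lbr L x y) c = - psign (i * j) (pev_skew L (lbr L y x) c))
    \<and> (\<forall>i j x y z c d. homog L i x \<longrightarrow> homog L j y \<longrightarrow>
          pev L (lbr L x (pev L (lbr L y z) d)) c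
          = pev L (lbr L (pev L (lbr L x y) c) z) (c + d)
            + psign (i * j) (pev L (lbr L y (pev L (lbr L x z) c)) d))"

definition center_zero :: "('a::zero, 'b) lcs_scheme \<Rightarrow> bool" where
  "center_zero L \<longleftrightarrow> (\<forall>x. (\<forall>y. lbr L x y = 0) \<longrightarrow> x = 0)"

definition conf_bilin :: "('a::ab_group_add, 'b) lcs_scheme \<Rightarrow> nat \<Rightarrow> ('a \<Rightarrow> 'a \<Rightarrow> 'a poly) \<Rightarrow> bool" where
  "conf_bilin L k \<phi> \<longleftrightarrow> k < 2
    \<and> (\<forall>y. lin (scal L) (pscal L) (\<lambda>x. \<phi> x y))
    \<and> (\<forall>x. lin (scal L) (pscal L) (\<phi> x))
    \<and> (\<forall>x y c. pev L (\<phi> (der L x) y) c = scal L (- c) (pev L (\<phi> x y) c))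
    \<and> (\<forall>x y c. pev L (\<phi> x (der L y)) c
                = der L (pev L (\<phi> x y) c) + scal L c (pev L (\<phi> x y) c))
    \<and> (\<forall>i j x y. homog L i x \<longrightarrow> homog L j y \<longrightarrow>
          (\<forall>n. homog L ((i + j + k) mod 2) (coeff (\<phi> x y) n)))"

definition super_biderivation :: "('a::ab_group_add, 'b) lcs_scheme \<Rightarrow> nat \<Rightarrow> ('a \<Rightarrow> 'a \<Rightarrow> 'a poly) \<Rightarrow> bool" where
  "super_biderivation L k \<phi> \<longleftrightarrow> conf_bilin L k \<phi>
    \<and> (\<forall>i j x y c. homog L i x \<longrightarrow> homog L j y \<longrightarrow>
          pev L (\<phi> x y) c = - psign (i * j) (pev_skew L (\<phi> y x) c))
    \<and> (\<forall>i j x y z c d. homog L i x \<longrightarrow> homog L j y \<longrightarrow>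
          pev L (\<phi> x (pev L (lbr L y z) d)) c
          = pev L (lbr L (pev L (\<phi> x y) c) z) (c + d)
            + psign (i * j) (pev L (lbr L y (pev L (\<phi> x z) c)) d))"

text \<open>element of the centroid of degree k (c plays lambda, d plays mu)\<close>
definition centroid :: "('a::ab_group_add, 'b) lcs_scheme \<Rightarrow> nat \<Rightarrow> ('a \<Rightarrow> 'a poly) \<Rightarrow> bool" where
  "centroid L k \<alpha> \<longleftrightarrow> k < 2
    \<and> lin (scal L) (pscal L) \<alpha>
    \<and> (\<forall>i x. homog L i x \<longrightarrow> (\<forall>n. homog L ((i + k) mod 2) (coeff (\<alpha> x) n)))
    \<and> (\<forall>i x y c d. homog L i x \<longrightarrow>
          pev L (\<alpha> (pev L (lbr L x y) d)) c = psign (i * k) (pev L (lbr L x (pev L (\<alpha> y) c)) d)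
        \<and> pev L (\<alpha> (pev L (lbr L x y) d)) c = pev L (lbr L (pev L (\<alpha> x) c) y) d)"

text \<open>A finite-dimensional associative commutative algebra with unity, realised
  (after choice of a basis indexed by the finite type 'i) on C^'i with multiplication m.\<close>
definition comm_alg :: "(('i::finite \<Rightarrow> complex) \<Rightarrow> ('i \<Rightarrow> complex) \<Rightarrow> ('i \<Rightarrow> complex)) \<Rightarrow> bool" where
  "comm_alg m \<longleftrightarrow> (\<forall>a b c. m (a + b) c = m a c + m b c)
    \<and> (\<forall>s a b. m (\<lambda>i. s * a i) b = (\<lambda>i. s * m a b i))
    \<and> (\<forall>a b. m a b = m b a)
    \<and> (\<forall>a b c. m (m a b) c = m a (m b c))
    \<and> (\<exists>u. \<forall>a. m u a = a)"

text \<open>L (x) C^'i is identified with 'i \<Rightarrow> L; pure tensors x (x) a\<close>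
definition tens :: "('a, 'b) lcs_scheme \<Rightarrow> 'a \<Rightarrow> ('i \<Rightarrow> complex) \<Rightarrow> ('i \<Rightarrow> 'a)" where
  "tens L x a = (\<lambda>i. scal L (a i) x)"

definition tens_poly :: "('a::zero, 'b) lcs_scheme \<Rightarrow> 'a poly \<Rightarrow> ('i \<Rightarrow> complex) \<Rightarrow> ('i \<Rightarrow> 'a) poly" where
  "tens_poly L p a = map_poly (\<lambda>v. tens L v a) p"

definition basisv :: "'i \<Rightarrow> 'i \<Rightarrow> complex" where
  "basisv i = (\<lambda>j. if j = i then 1 else 0)"

text \<open>the current Lie conformal superalgebra L (x) A: bracket is the bilinear extension of
  [(x (x) a)_lambda (y (x) b)] = [x_lambda y] (x) ab\<close>
definition current :: "('a::ab_group_add, 'b) lcs_scheme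
    \<Rightarrow> (('i::finite \<Rightarrow> complex) \<Rightarrow> ('i \<Rightarrow> complex) \<Rightarrow> ('i \<Rightarrow> complex)) \<Rightarrow> ('i \<Rightarrow> 'a) lcs" where
  "current L m = \<lparr> scal = (\<lambda>c f i. scal L c (f i)),
                   der = (\<lambda>f i. der L (f i)),
                   ev_part = {f. \<forall>i. f i \<in> ev_part L},
                   od_part = {f. \<forall>i. f i \<in> od_part L},
                   lbr = (\<lambda>f g. \<Sum>i\<in>UNIV. \<Sum>j\<in>UNIV.
                            tens_poly L (lbr L (f i) (g j)) (m (basisv i) (basisv j))) \<rparr>"

end

theory Submission
  imports Defs
begin

text \<open>Every coordinate of \<open>(x, y) \<mapsto> \<phi>(x \<otimes> 1, y \<otimes> 1)\<close> is a biderivation of L, hence given by a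
  centroid element \<open>\<alpha>\<^sub>s\<close>.  Subtracting \<open>\<Psi>(x \<otimes> a, y \<otimes> b) = \<Sum>\<^sub>s \<psi>\<^sub>s(x, y) \<otimes> e\<^sub>s ab\<close> leaves a
  biderivation D of \<open>L \<otimes> A\<close> that vanishes on \<open>L \<otimes> 1\<close>.  Computing \<open>D(x \<otimes> a, [y \<otimes> 1, z \<otimes> b])\<close> with
  one Leibniz term gone shows that D is module-like in one argument: first for a = 1, where
  this and the Leibniz rule in the other argument force \<open>D(x \<otimes> b, y \<otimes> 1) = 0\<close> because the centre of L
  is zero; then, by this vanishing, in both arguments for arbitrary a and b, which forces D = 0.\<close>

section \<open>Linear maps and polynomial evaluation\<close>

text \<open>\<open>L\<close> need not be perfect, so its elements are not sums of brackets. The zero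
  centre makes up for this: a value of a form vanishes once all its brackets with elements
  \<open>w\<close> vanish, and linearity moves \<open>w\<close> into an argument. Forms are
  therefore only tested on brackets, where skew-symmetry and the Jacobi identity can act. The main
  obstacle is a clash of signs. The Leibniz rule of a biderivation has no sign for its degree,
  whereas the centroid relation has one. In odd degree this is felt twice: the vanishing argument
  breaks down at three odd arguments, and a biderivation has to be twisted by the parity
  automorphism before its centroid element is taken. That twist is the origin of the sign
  \<open>(-1)^(|\<phi>|(|x|+|y|))\<close> in the conclusion. The hypothesis leaves the degree of
  \<alpha> open, so all coordinates are first brought to the degree of \<phi>; only then is the map
  sending \<open>x \<otimes> a\<close> to the sum of the
  \<open>\<alpha>\<^sub>s(x) \<otimes> e\<^sub>s a\<close> homogeneous.\<close>

lemma lin_add: "lin s t f \<Longrightarrow> f (x + y) = f x + f y"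
  by (simp only: lin_def)

lemma lin_scale: "lin s t f \<Longrightarrow> f (s a x) = t a (f x)"
  by (simp only: lin_def)

context
  fixes f :: "'a::ab_group_add \<Rightarrow> 'b::ab_group_add" and s t
  assumes f: "lin s t f"
begin

lemma lin_zero: "f 0 = 0"
  using lin_add[OF f, of 0 0] by simp

lemma lin_minus: "f (- x) = - f x"
  using lin_add[OF f, of x "- x"] lin_zero by (simp add: minus_unique)

lemma lin_diff: "f (x - y) = f x - f y"
  using lin_add[OF f, of x "- y"] lin_minus by simp

lemma lin_sum: "f (\<Sum>i\<in>I. g i) = (\<Sum>i\<in>I. f (g i))"
  by (induction I rule: infinite_finite_induct) (simp_all add: lin_zero lin_add[OF f])

lemma lin_psign: "f (psign k x) = psign k (f x)"
  by (simp add: psign_def lin_minus)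

end

lemma psign_psign: "psign a (psign b v) = psign (a + b) v"
  by (simp add: psign_def)

lemma psign_zero [simp]: "psign a 0 = 0"
  by (simp add: psign_def)

locale cvspace =
  fixes L :: "'a::ab_group_add lcs"
  assumes cvs: "cvs (scal L)"
begin

abbreviation sc where "sc \<equiv> scal L"

lemma sc_1 [simp]: "sc 1 x = x"
  and sc_sc: "sc a (sc b x) = sc (a * b) x"
  and sc_add: "sc a (x + y) = sc a x + sc a y"
  and sc_add_left: "sc (a + b) x = sc a x + sc b x"
  using cvs by (auto simp: cvs_def)

lemma lin_sc: "lin sc sc (sc a)"
  by (simp add: lin_def sc_add sc_sc mult.commute)

lemma sc_zero [simp]: "sc a 0 = 0"
  by (rule lin_zero[OF lin_sc])

lemma sc_zero_left [simp]: "sc 0 x = 0"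
  using sc_add_left[of 0 0 x] by simp

lemma sc_minus: "sc a (- x) = - sc a x"
  by (rule lin_minus[OF lin_sc])

lemma sc_minus_left: "sc (- a) x = - sc a x"
  using sc_add_left[of a "-a" x] by (metis add.right_inverse minus_unique sc_zero_left)

lemma sc_diff: "sc a (x - y) = sc a x - sc a y"
  by (rule lin_diff[OF lin_sc])

lemma sc_sum: "sc a (\<Sum>i\<in>I. g i) = (\<Sum>i\<in>I. sc a (g i))"
  by (rule lin_sum[OF lin_sc])

lemma sc_sum_left: "sc (\<Sum>i\<in>I. g i) x = (\<Sum>i\<in>I. sc (g i) x)"
  by (induction I rule: infinite_finite_induct) (simp_all add: sc_add_left)

lemma sc_cancel: "a \<noteq> 0 \<Longrightarrow> sc a x = 0 \<Longrightarrow> x = 0"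
  using sc_sc[of "inverse a" a x] by simp

lemma double_zero: "x = - x \<Longrightarrow> x = (0::'a)"
  using sc_cancel[of 2 x] sc_add_left[of 1 1 x] by (metis one_add_one sc_1 add.left_inverse zero_neq_numeral)

section \<open>Evaluation of polynomials at complex numbers\<close>

lemma coeff_pscal: "coeff (pscal L a p) n = sc a (coeff p n)"
  by (simp add: pscal_def coeff_map_poly)

lemma pev_upto: "degree p \<le> N \<Longrightarrow> pev L p c = (\<Sum>n\<le>N. sc (c ^ n) (coeff p n))"
  unfolding pev_def by (rule sum.mono_neutral_left) (auto simp: coeff_eq_0)

lemma pev_zero [simp]: "pev L 0 c = 0"
  by (simp add: pev_def)

lemma pev_add: "pev L (p + q) c = pev L p c + pev L q c"
proof -
  define N where "N = max (degree p) (degree q)"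
  have "degree p \<le> N" "degree q \<le> N" "degree (p + q) \<le> N"
    by (auto simp: N_def degree_add_le_max)
  then show ?thesis by (simp add: pev_upto sc_add sum.distrib)
qed

lemma pev_minus: "pev L (- p) c = - pev L p c"
  by (simp add: pev_def sc_minus sum_negf)

lemma pev_diff: "pev L (p - q) c = pev L p c - pev L q c"
  using pev_add[of p "-q" c] by (simp add: pev_minus)

lemma pev_sum: "pev L (\<Sum>i\<in>I. p i) c = (\<Sum>i\<in>I. pev L (p i) c)"
  by (induction I rule: infinite_finite_induct) (simp_all add: pev_add)

lemma degree_pscal_le: "degree (pscal L a p) \<le> degree p"
  by (rule degree_le) (simp add: coeff_pscal coeff_eq_0)

lemma pev_pscal: "pev L (pscal L a p) c = sc a (pev L p c)"
  using pev_upto[OF degree_pscal_le] pev_upto[of p "degree p"]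
  by (simp add: coeff_pscal sc_sum sc_sc mult.commute)

lemma pev_psign: "pev L (psign k p) c = psign k (pev L p c)"
  by (simp add: psign_def pev_minus)

text \<open>Subtracting \<open>2 ^ Suc N\<close> times the relation at \<open>c\<close> from the
  relation at \<open>2 * c\<close> removes the top term and multiplies every lower coefficient by a
  nonzero number, so induction applies.\<close>

lemma vanishing_power_sum:
  assumes "\<And>c. (\<Sum>n\<le>N. sc (c ^ n) (v n)) = 0" and "n \<le> N"
  shows "v n = 0"
  using assms
proof (induction N arbitrary: v n)
  case 0
  have "sc (1 ^ 0) (v 0) = 0" using 0(1)[of 1] 
    by (simp only: atMost_0 sum.insert finite.emptyI empty_iff sum.empty simp_thms add_0_right)
  with 0(2) show ?case by simp
next
  case (Suc N)
  have "(\<Sum>n\<le>N. sc (c ^ n) (sc (2 ^ n - 2 ^ Suc N) (v n))) = 0" for c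
  proof -
    have eq: "sc ((2 * c) ^ n) (v n) - sc (2 ^ Suc N) (sc (c ^ n) (v n))
        = sc (c ^ n) (sc (2 ^ n - 2 ^ Suc N) (v n))" for n
    proof -
      have "(2 * c) ^ n = c ^ n * (2 ^ n - 2 ^ Suc N) + 2 ^ Suc N * c ^ n"
        by (simp add: algebra_simps power_mult_distrib)
      then show ?thesis by (simp only: sc_sc sc_add_left add_diff_cancel_right')
    qed
    have "(\<Sum>n\<le>Suc N. sc (c ^ n) (sc (2 ^ n - 2 ^ Suc N) (v n)))
        = (\<Sum>n\<le>Suc N. sc ((2 * c) ^ n) (v n)) - sc (2 ^ Suc N) (\<Sum>n\<le>Suc N. sc (c ^ n) (v n))"
      by (simp only: eq[symmetric] sum_subtractf sc_sum)
    also have "\<dots> = 0"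
      by (simp only: Suc.prems(1) sc_zero diff_self)
    finally show ?thesis by (simp only: sum.atMost_Suc diff_self sc_zero_left sc_zero add_0_right)
  qed
  note IH = Suc.IH[OF this]
  have low: "v n = 0" if "n \<le> N" for n
  proof (rule sc_cancel[OF _ IH[OF that]])
    have "(2::nat) ^ n < 2 ^ Suc N" using that by (intro power_strict_increasing) simp_all
    then have "(2::nat) ^ n \<noteq> 2 ^ Suc N" by simp
    then have "of_nat (2 ^ n) \<noteq> (of_nat (2 ^ Suc N) :: complex)" by (metis of_nat_eq_iff)
    then show "(2::complex) ^ n - 2 ^ Suc N \<noteq> 0" by simp
  qed
  moreover have "v (Suc N) = 0"
    using Suc.prems(1)[of 1] low by (simp only: sum.atMost_Suc power_one sc_1) simp
  ultimately show ?case using Suc.prems(2) le_Suc_eq by auto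
qed

lemma pev_inject:
  assumes "\<And>c. pev L p c = pev L q c" shows "p = q"
proof (rule poly_eqI)
  fix n
  define N where "N = max n (degree (p - q))"
  have "(\<Sum>n\<le>N. sc (c ^ n) (coeff (p - q) n)) = 0" for c
    using assms[of c] pev_upto[of "p - q" N c] by (simp add: N_def pev_diff)
  from vanishing_power_sum[OF this, of n] show "coeff p n = coeff q n"
    by (simp add: N_def)
qed

lemma pev_eq_zero_iff: "(\<forall>c. pev L p c = 0) \<longleftrightarrow> p = 0"
  using pev_inject[of p 0] by auto

lemma lin_pev: "lin s (pscal L) f \<Longrightarrow> lin s sc (\<lambda>x. pev L (f x) c)"
  by (simp add: lin_def pev_add pev_pscal)

text \<open>By \<open>pev_inject\<close>, \<open>q\<close> is the coefficientwise image of
  \<open>p\<close>. This transports identities between evaluations to \<open>pev_skew\<close>, where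
  an operator instead of a number is substituted.\<close>

lemma coeff_of_pev:
  assumes "lin sc sc g" and "\<And>c. pev L q c = g (pev L p c)"
  shows "coeff q n = g (coeff p n)"
proof -
  note g = lin_zero[OF assms(1)] lin_sum[OF assms(1)] lin_scale[OF assms(1)]
  have "degree (map_poly g p) \<le> degree p"
    by (rule degree_le) (simp add: coeff_map_poly g coeff_eq_0)
  then have "pev L (map_poly g p) c = g (pev L p c)" for c
    by (simp add: pev_upto[where N = "degree p"] g coeff_map_poly)
  with assms(2) have "q = map_poly g p" by (intro pev_inject) simp
  then show ?thesis by (simp add: coeff_map_poly g)
qed

end

section \<open>Lie conformal superalgebras\<close>

locale lcsa = fixes L :: "'a::ab_group_add lcs" assumes lcsa: "is_LCSA L"

sublocale lcsa \<subseteq> cvspace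
  using lcsa by unfold_locales (simp add: is_LCSA_def)

context lcsa
begin

abbreviation br where "br c x y \<equiv> pev L (lbr L x y) c"
abbreviation T where "T c \<equiv> \<lambda>v. sc (- c) v - der L v"

section \<open>The substitution of \<open>- c - \<partial>\<close>\<close>

lemma lin_der: "lin sc sc (der L)"
  using lcsa by (simp add: is_LCSA_def)

lemma lin_T: "lin sc sc (T c)"
  by (simp add: lin_def lin_add[OF lin_der] lin_scale[OF lin_der] sc_add sc_sc sc_diff mult.commute)

lemma lin_T_pow: "lin sc sc (T c ^^ n)"
proof (induction n)
  case (Suc n)
  show ?case by (simp only: lin_def funpow.simps o_apply lin_add[OF Suc.IH] lin_scale[OF Suc.IH]
      lin_add[OF lin_T] lin_scale[OF lin_T] simp_thms)
qed (simp add: lin_def)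

lemma pev_skew_upto: "degree p \<le> N \<Longrightarrow> pev_skew L p c = (\<Sum>n\<le>N. (T c ^^ n) (coeff p n))"
  unfolding pev_skew_def
  by (rule sum.mono_neutral_left) (auto simp: coeff_eq_0 lin_zero[OF lin_T_pow])

lemma pev_skew_zero [simp]: "pev_skew L 0 c = 0"
  by (simp add: pev_skew_def)

lemma pev_skew_add: "pev_skew L (p + q) c = pev_skew L p c + pev_skew L q c"
proof -
  define N where "N = max (degree p) (degree q)"
  have "degree p \<le> N" "degree q \<le> N" "degree (p + q) \<le> N"
    by (auto simp: N_def degree_add_le_max)
  then show ?thesis by (simp add: pev_skew_upto lin_add[OF lin_T_pow] sum.distrib)
qed

lemma pev_skew_pscal: "pev_skew L (pscal L a p) c = sc a (pev_skew L p c)"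
  using pev_skew_upto[OF degree_pscal_le] pev_skew_upto[of p "degree p"]
  by (simp add: coeff_pscal sc_sum lin_scale[OF lin_T_pow])

lemma pev_skew_minus: "pev_skew L (- p) c = - pev_skew L p c"
  by (simp add: pev_skew_def lin_minus[OF lin_T_pow] sum_negf)

lemma pev_skew_diff: "pev_skew L (p - q) c = pev_skew L p c - pev_skew L q c"
  using pev_skew_add[of p "-q" c] by (simp add: pev_skew_minus)

lemma pev_skew_sum: "pev_skew L (\<Sum>i\<in>I. p i) c = (\<Sum>i\<in>I. pev_skew L (p i) c)"
  by (induction I rule: infinite_finite_induct) (simp_all add: pev_skew_add)

lemma pev_skew_psign: "pev_skew L (psign k p) c = psign k (pev_skew L p c)"
  by (simp add: psign_def pev_skew_minus)

text \<open>Intertwining passes from \<open>T c\<close> to its powers. The intended \<open>g\<close>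
  is a bracket with a fixed left factor, which shifts the parameter of \<open>T\<close>.\<close>

lemma pev_skew_intertwine:
  assumes g: "lin sc sc g" and T: "\<And>v. g (T c v) = T c' (g v)"
    and q: "\<And>e. pev L q e = g (pev L p e)"
  shows "pev_skew L q c' = g (pev_skew L p c)"
proof -
  note co = coeff_of_pev[OF g q]
  have "g ((T c ^^ n) v) = (T c' ^^ n) (g v)" for n v
    by (induction n) (simp_all add: T)
  moreover have "degree q \<le> degree p"
    by (rule degree_le) (simp add: co lin_zero[OF g] coeff_eq_0)
  ultimately show ?thesis
    using pev_skew_upto[of q "degree p"] pev_skew_upto[of p "degree p"]
    by (simp add: lin_sum[OF g] co)
qed

text \<open>If \<open>\<partial>\<close> acts under g as the scalar \<open>- c - d\<close>, then substituting \<open>- d - \<partial>\<close> amounts to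
  substituting c.\<close>
lemma pev_skew_collapse:
  assumes g: "lin sc sc g" and T: "\<And>v. g (T d v) = sc c (g v)"
  shows "g (pev_skew L p d) = g (pev L p c)"
proof -
  have "g ((T d ^^ n) v) = sc (c ^ n) (g v)" for n v
    by (induction n) (simp_all add: T sc_sc)
  then show ?thesis
    by (simp add: lin_sum[OF g] lin_scale[OF g] pev_skew_def pev_def)
qed

section \<open>The grading\<close>

lemma homog_cases: "homog L i x \<Longrightarrow> i = 0 \<or> i = 1"
  by (auto simp: homog_def)

lemma subsp_homog: "i < 2 \<Longrightarrow> subsp sc {x. homog L i x}"
  using lcsa by (auto simp: homog_def is_LCSA_def subsp_def less_2_cases_iff)

lemma homog_zero: "i < 2 \<Longrightarrow> homog L i 0"
  and homog_add: "homog L i x \<Longrightarrow> homog L i y \<Longrightarrow> homog L i (x + y)"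
  and homog_sc: "homog L i x \<Longrightarrow> homog L i (sc a x)"
  using subsp_homog[of i] homog_cases[of i x] by (auto simp: subsp_def)

lemma homog_minus: "homog L i x \<Longrightarrow> homog L i (- x)"
  using homog_sc[of i x "-1"] by (simp add: sc_minus_left)

lemma homog_psign: "homog L i x \<Longrightarrow> homog L i (psign k x)"
  by (simp add: psign_def homog_minus)

lemma homog_diff: "homog L i x \<Longrightarrow> homog L i y \<Longrightarrow> homog L i (x - y)"
  using homog_add[of i x "-y"] homog_minus by simp

lemma homog_sum: "i < 2 \<Longrightarrow> (\<And>s. s \<in> S \<Longrightarrow> homog L i (f s)) \<Longrightarrow> homog L i (\<Sum>s\<in>S. f s)"
  by (induction S rule: infinite_finite_induct) (auto simp: homog_zero homog_add)

lemma homog_der: "homog L i x \<Longrightarrow> homog L i (der L x)"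
  using lcsa by (auto simp: homog_def is_LCSA_def)

lemma homog_pev: "i < 2 \<Longrightarrow> (\<And>n. homog L i (coeff p n)) \<Longrightarrow> homog L i (pev L p c)"
  unfolding pev_def by (intro homog_sum homog_sc)

lemma homog_decomp: obtains u v where "homog L 0 u" "homog L 1 v" "x = u + v"
proof -
  have "\<forall>x. \<exists>u\<in>ev_part L. \<exists>v\<in>od_part L. x = u + v"
    using lcsa unfolding is_LCSA_def by (elim conjE)
  then show thesis using that by (auto simp: homog_def)
qed

lemma homog_disjoint: "homog L i x \<Longrightarrow> homog L j x \<Longrightarrow> i \<noteq> j \<Longrightarrow> x = 0"
proof -
  have "ev_part L \<inter> od_part L = {0}"
    using lcsa unfolding is_LCSA_def by (elim conjE)
  then show "homog L i x \<Longrightarrow> homog L j x \<Longrightarrow> i \<noteq> j \<Longrightarrow> x = 0"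
    by (auto simp: homog_def)
qed

lemma lin_eq_zero:
  fixes f :: "'a \<Rightarrow> 'b::ab_group_add"
  assumes "lin sc t f" and "\<And>i x. homog L i x \<Longrightarrow> f x = 0" shows "f x = 0"
proof -
  obtain u v where "homog L 0 u" "homog L 1 v" "x = u + v" by (rule homog_decomp)
  then show ?thesis using assms(2) by (simp add: lin_add[OF assms(1)])
qed

section \<open>Conformal bilinear maps, skew-symmetry and the centre\<close>

lemma conf_bilin_lbr: "conf_bilin L 0 (lbr L)"
  using lcsa unfolding is_LCSA_def conf_bilin_def by simp

lemma br_skew: "homog L i x \<Longrightarrow> homog L j y \<Longrightarrow> br c x y = - psign (i * j) (pev_skew L (lbr L y x) c)"
proof -
  have "\<forall>i j x y c. homog L i x \<longrightarrow> homog L j y \<longrightarrow>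
      br c x y = - psign (i * j) (pev_skew L (lbr L y x) c)"
    using lcsa unfolding is_LCSA_def by (elim conjE)
  then show "homog L i x \<Longrightarrow> homog L j y \<Longrightarrow> br c x y = - psign (i * j) (pev_skew L (lbr L y x) c)"
    by blast
qed

lemma jacobi: "homog L i x \<Longrightarrow> homog L j y \<Longrightarrow>
    br c x (br d y z) = br (c + d) (br c x y) z + psign (i * j) (br d y (br c x z))"
proof -
  have "\<forall>i j x y z c d. homog L i x \<longrightarrow> homog L j y \<longrightarrow>
      br c x (br d y z) = br (c + d) (br c x y) z + psign (i * j) (br d y (br c x z))"
    using lcsa unfolding is_LCSA_def by (elim conjE)
  then show "homog L i x \<Longrightarrow> homog L j y \<Longrightarrow>
      br c x (br d y z) = br (c + d) (br c x y) z + psign (i * j) (br d y (br c x z))"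
    by blast
qed

text \<open>The two rules for \<open>T\<close> restate sesquilinearity for the operator iterated in
  \<open>pev_skew\<close>; they supply the premises of \<open>pev_skew_collapse\<close> and
  \<open>pev_skew_intertwine\<close>.\<close>

lemma conf_bilinD:
  assumes "conf_bilin L k \<phi>"
  shows lin_pev_left: "lin sc sc (\<lambda>x. pev L (\<phi> x y) c)"
    and lin_pev_right: "lin sc sc (\<lambda>y. pev L (\<phi> x y) c)"
    and pev_T_left: "pev L (\<phi> (T d x) y) (c + d) = sc c (pev L (\<phi> x y) (c + d))"
    and pev_T_right: "pev L (\<phi> x (T d y)) c = T (d + c) (pev L (\<phi> x y) c)"
    and pev_homog: "homog L i x \<Longrightarrow> homog L j y \<Longrightarrow> homog L ((i + j + k) mod 2) (pev L (\<phi> x y) c)"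
proof -
  show l: "lin sc sc (\<lambda>x. pev L (\<phi> x y) c)" for y c
    using assms by (simp add: lin_pev conf_bilin_def)
  show r: "lin sc sc (\<lambda>y. pev L (\<phi> x y) c)" for x c
    using assms by (simp add: lin_pev conf_bilin_def)
  have "pev L (\<phi> (der L x) y) (c + d) = sc (- (c + d)) (pev L (\<phi> x y) (c + d))"
    using assms by (simp add: conf_bilin_def)
  moreover have "sc (- d) v - sc (- (c + d)) v = sc c v" for v
    using sc_add_left[of "- (c + d)" c v] by (simp add: sc_minus_left[symmetric])
  ultimately show "pev L (\<phi> (T d x) y) (c + d) = sc c (pev L (\<phi> x y) (c + d))"
    unfolding lin_diff[OF l] lin_scale[OF l] by simp
  have "pev L (\<phi> x (der L y)) c = der L (pev L (\<phi> x y) c) + sc c (pev L (\<phi> x y) c)"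
    using assms by (simp add: conf_bilin_def)
  moreover have "sc (- d) v - (w + sc c v) = sc (- (d + c)) v - w" for v w
    using sc_add_left[of "- d" "- c" v] by (simp add: sc_minus_left algebra_simps)
  ultimately show "pev L (\<phi> x (T d y)) c = T (d + c) (pev L (\<phi> x y) c)"
    unfolding lin_diff[OF r] lin_scale[OF r] by simp
  show "homog L i x \<Longrightarrow> homog L j y \<Longrightarrow> homog L ((i + j + k) mod 2) (pev L (\<phi> x y) c)"
    using assms by (intro homog_pev) (auto simp: conf_bilin_def)
qed

lemmas lin_br_left = lin_pev_left[OF conf_bilin_lbr]
lemmas lin_br_right = lin_pev_right[OF conf_bilin_lbr]

lemma homog_br: "homog L i x \<Longrightarrow> homog L j y \<Longrightarrow> homog L ((i + j) mod 2) (br c x y)"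
  using pev_homog[OF conf_bilin_lbr, of i x j y] by simp

lemma br_zero [simp]: "br c 0 y = 0" "br c x 0 = 0"
  using lin_zero[OF lin_br_left] lin_zero[OF lin_br_right] by auto

lemma br_psign: "br c (psign k x) y = psign k (br c x y)" "br c x (psign k y) = psign k (br c x y)"
  by (rule lin_psign[OF lin_br_left], rule lin_psign[OF lin_br_right])

text \<open>In the first argument of a form evaluated at \<open>c + d\<close>,
  \<open>\<partial>\<close> acts as \<open>- (c + d)\<close>. Hence the substitution
  \<open>- d - \<partial>\<close> caused by skew-symmetry of the inner bracket is just the number
  \<open>c\<close>.\<close>

lemma flip_left:
  assumes "conf_bilin L k \<phi>" and "homog L i y" "homog L j z"
  shows "pev L (\<phi> (br d y z) x) (c + d) = - psign (i * j) (pev L (\<phi> (br c z y) x) (c + d))"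
proof -
  note lin = lin_pev_left[OF assms(1), of x "c + d"]
  have "pev L (\<phi> (pev_skew L (lbr L z y) d) x) (c + d) = pev L (\<phi> (br c z y) x) (c + d)"
    by (rule pev_skew_collapse[OF lin]) (rule pev_T_left[OF assms(1)])
  then show ?thesis
    unfolding br_skew[OF assms(2,3)] by (simp add: psign_def lin_minus[OF lin])
qed

text \<open>\<open>center_zero\<close> speaks of brackets with \<open>w\<close> on the left;
  skew-symmetry moves \<open>w\<close> there, and this is where homogeneity of \<open>w\<close>
  enters.\<close>

lemma center_left:
  assumes "center_zero L" and "homog L i w" and zero: "\<And>j y d. homog L j y \<Longrightarrow> br d y w = 0"
  shows "w = 0"
proof -
  have "lbr L w y = 0" if "homog L j y" for j y
  proof -
    have "lbr L y w = 0" using zero[OF that] pev_eq_zero_iff by blast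
    then show ?thesis by (intro pev_inject) (simp add: br_skew[OF assms(2) that])
  qed
  moreover have "lin sc (pscal L) (lbr L w)" using conf_bilin_lbr by (simp add: conf_bilin_def)
  ultimately have "lbr L w y = 0" for y using lin_eq_zero by blast
  then show ?thesis using assms(1) by (auto simp: center_zero_def)
qed

lemma center_right:
  assumes "center_zero L" and "\<And>j y d. homog L j y \<Longrightarrow> br d w y = 0"
  shows "w = 0"
proof -
  have "lbr L w y = 0" if "homog L j y" for j y
    using assms(2)[OF that] pev_eq_zero_iff by blast
  moreover have "lin sc (pscal L) (lbr L w)" using conf_bilin_lbr by (simp add: conf_bilin_def)
  ultimately have "lbr L w y = 0" for y using lin_eq_zero by blast
  then show ?thesis using assms(1) by (auto simp: center_zero_def)
qed

text \<open>Skew-symmetry trades linearity in the second argument for linearity in the first; the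
  sign \<open>i * j\<close> is absorbed by the parity of \<open>br d y z\<close>. Two forms occur
  because interchanging \<open>x \<otimes> a\<close> and \<open>y \<otimes> b\<close> also
  interchanges \<open>a\<close> and \<open>b\<close>.\<close>

lemma transpose_Leibniz:
  assumes q: "homog L i x" "homog L j y" "homog L l z"
    and skew: "\<And>i j x y c. homog L i x \<Longrightarrow> homog L j y \<Longrightarrow>
        pev L (q x y) c = - psign (i * j) (pev_skew L (p y x) c)"
    and p: "\<And>c. pev L (p x (br d y z)) c = psign (i * j) (br d y (pev L (p x z) c))"
  shows "pev L (q (br d y z) x) (c + d) = br d y (pev L (q z x) c)"
proof -
  have lin: "lin sc sc (\<lambda>v. psign (i * j) (br d y v))"
    by (simp add: lin_def lin_add[OF lin_br_right] lin_scale[OF lin_br_right] psign_def sc_minus)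
  have "pev_skew L (p x (br d y z)) (c + d) = psign (i * j) (br d y (pev_skew L (p x z) c))"
    by (rule pev_skew_intertwine[OF lin _ p])
      (simp add: pev_T_right[OF conf_bilin_lbr] psign_def sc_minus lin_minus[OF lin_der])
  moreover have "pev L (q (br d y z) x) (c + d)
      = - psign ((j + l) mod 2 * i) (pev_skew L (p x (br d y z)) (c + d))"
    by (rule skew[OF homog_br[OF q(2,3)] q(1)])
  ultimately show ?thesis unfolding skew[OF q(3,1)]
    by (auto simp: psign_def lin_minus[OF lin_br_right])
qed

end

section \<open>Forms that commute with the left adjoint action\<close>

text \<open>Serves two kinds of forms: \<open>D b u t\<close>, which also satisfies the Leibniz rule
  in its second argument, and later \<open>D a b t\<close>, which is linear in both
  arguments.\<close>

locale adjoint_linear_form = lcsa L for L :: "'a::ab_group_add lcs" +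
  fixes k :: nat and q :: "'a \<Rightarrow> 'a \<Rightarrow> 'a poly"
  assumes center: "center_zero L"
    and conf_bilin_q: "conf_bilin L k q"
    and q_left: "\<And>i j l x y z c d. homog L i x \<Longrightarrow> homog L j y \<Longrightarrow> homog L l z \<Longrightarrow>
      pev L (q (br d y z) x) (c + d) = br d y (pev L (q z x) c)"
begin

abbreviation Q where "Q c y x \<equiv> pev L (q y x) c"

lemma homog_Q: "homog L i x \<Longrightarrow> homog L j y \<Longrightarrow> homog L ((i + j + k) mod 2) (Q c x y)"
  by (rule pev_homog[OF conf_bilin_q])

text \<open>By \<open>q_left\<close>, the value at a bracket is either factor acting on the value at
  the other one, up to the flip of that bracket.\<close>

lemma exchange:
  assumes "homog L i x" "homog L j w" "homog L l z"
  shows "br f w (Q c z x) = - psign (j * l) (br c z (Q f w x))"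
proof -
  have "br f w (Q c z x) = Q (c + f) (br f w z) x"
    using q_left[OF assms] by simp
  also have "\<dots> = - psign (j * l) (Q (f + c) (br c z w) x)"
    using flip_left[OF conf_bilin_q assms(2,3), of f x c] by (simp add: add.commute)
  also have "Q (f + c) (br c z w) x = br c z (Q f w x)"
    by (rule q_left[OF assms(1,3,2)])
  finally show ?thesis .
qed

text \<open>Bracketing \<open>Q c y x\<close> with \<open>z\<close> gives the value at the bracket
  of \<open>z\<close> and \<open>y\<close>, so the zero centre reduces everything to brackets in the
  first argument.\<close>

lemma q_zeroI:
  assumes "\<And>i j l x y z c d. homog L i x \<Longrightarrow> homog L j y \<Longrightarrow> homog L l z \<Longrightarrow>
      Q (c + d) (br d y z) x = 0"
  shows "q y x = 0"
proof -
  have hom: "q y x = 0" if h: "homog L i y" "homog L j x" for i j y x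
  proof (rule pev_inject)
    fix c
    have "Q c y x = 0"
    proof (rule center_left[OF center homog_Q[OF h]])
      fix l z d assume z: "homog L l z"
      show "br d z (Q c y x) = 0"
        using q_left[OF h(2) z h(1), where c = c and d = d] assms[OF h(2) z h(1), where c = c and d = d]
        by simp
    qed
    then show "Q c y x = pev L 0 c" by simp
  qed
  have lin: "lin sc (pscal L) (q y)" "lin sc (pscal L) (\<lambda>y. q y x)" for x y
    using conf_bilin_q by (simp_all add: conf_bilin_def)
  have "q y x = 0" if "homog L i y" for i y
    by (rule lin_eq_zero[OF lin(1) hom[OF that]])
  then show ?thesis by (rule lin_eq_zero[OF lin(2)])
qed

text \<open>Taking \<open>y\<close> out of the first and \<open>x\<close> out of the second argument
  in either order shows that their adjoint actions supercommute on values of \<open>Q\<close>. By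
  the Jacobi identity the bracket of \<open>y\<close> and \<open>x\<close> kills these values, and
  \<open>exchange\<close> moves that bracket into \<open>Q\<close>.\<close>

lemma q_zero_of_adjoint_linear_right:
  assumes q_right: "\<And>i j l x y z c d. homog L j y \<Longrightarrow> homog L i x \<Longrightarrow> homog L l z \<Longrightarrow>
      Q c y (br d x z) = psign (i * j) (br d x (Q c y z))"
  shows "q y x = 0"
proof (rule q_zeroI)
  fix i j l x y w and d e :: complex
  assume w: "homog L l w" and y: "homog L j y" and x: "homog L i x"
  show "Q (e + d) (br d y x) w = 0"
  proof (rule center_left[OF center homog_Q[OF homog_br[OF y x] w]])
    fix m z c assume z: "homog L m z"
    let ?w = "Q c z w"
    have "psign (i * m) (br d y (br e x ?w)) = br d y (Q c z (br e x w))"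
      using q_right[OF z x w] by (simp add: br_psign)
    also have "\<dots> = Q (c + d) (br d y z) (br e x w)"
      using q_left[OF homog_br[OF x w] y z] by simp
    also have "\<dots> = psign (i * ((j + m) mod 2)) (br e x (Q (c + d) (br d y z) w))"
      by (rule q_right[OF homog_br[OF y z] x w])
    also have "Q (c + d) (br d y z) w = br d y ?w"
      by (rule q_left[OF w y z])
    finally have "br (d + e) (br d y x) ?w = 0"
      unfolding jacobi[OF y x] by (auto simp: psign_def split: if_splits)
    then have "psign ((j + i) mod 2 * m) (br c z (Q (d + e) (br d y x) w)) = 0"
      using exchange[OF w homog_br[OF y x] z] by simp
    then show "br c z (Q (e + d) (br d y x) w) = 0"
      by (simp add: psign_def add.commute split: if_splits)
  qed
qed

context
  assumes q_Leibniz: "\<And>i j l x y z c d. homog L j y \<Longrightarrow> homog L i x \<Longrightarrow> homog L l z \<Longrightarrow>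
      Q c y (br d x z) = br (c + d) (Q c y x) z + psign (i * j) (br d x (Q c y z))"
begin

text \<open>A value with a bracket in each argument can be opened on the left or on the right first.
  The Jacobi identity cancels the doubly nested terms and leaves one relation between the values at
  \<open>(z, x)\<close> and at \<open>(z, w)\<close>.\<close>

lemma two_expansions:
  assumes x: "homog L i x" and y: "homog L j y" and z: "homog L l z" and w: "homog L h w"
  shows "psign (j * (l + i + k)) (br (c + e) (Q c z x) (br d y w))
    + psign (l * i) (br (d + e) (br d y x) (Q c z w)) = 0"
proof -
  have "Q (c + d) (br d y z) (br e x w) = br d y (Q c z (br e x w))"
    by (rule q_left[OF homog_br[OF x w] y z])
  also have "\<dots> = br d y (br (c + e) (Q c z x) w) + psign (i * l) (br d y (br e x (Q c z w)))"
    using q_Leibniz[OF z x w] by (simp add: lin_add[OF lin_br_right] br_psign)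
  finally have first: "Q (c + d) (br d y z) (br e x w) =
      br d y (br (c + e) (Q c z x) w) + psign (i * l) (br d y (br e x (Q c z w)))" .
  have "Q (c + d) (br d y z) (br e x w) =
      br (c + d + e) (br d y (Q c z x)) w
      + psign (i * ((j + l) mod 2)) (br e x (br d y (Q c z w)))"
    unfolding q_Leibniz[OF homog_br[OF y z] x w] q_left[OF x y z] q_left[OF w y z] ..
  with first jacobi[OF y homog_Q[OF z x, of c], where c = d and d = "c + e" and z = w]
    jacobi[OF y x, where c = d and d = e and z = "Q c z w"]
  show ?thesis by (auto simp: psign_def algebra_simps neg_eq_iff_add_eq_0)
qed

text \<open>The parameters \<open>d\<close>, \<open>e\<close>, \<open>f\<close> belong to
  \<open>y\<close>, \<open>x\<close>, \<open>w\<close> and are permuted with them. The outer bracket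
  with \<open>z\<close> is a probe for \<open>center_right\<close>.\<close>

abbreviation R where "R y x w d e f z \<equiv> br (d + e + f) (Q (d + e) (br d y x) w) z"

text \<open>\<open>exchange\<close> rewrites both terms of \<open>two_expansions\<close> as brackets
  of \<open>z\<close> with the two values to be compared. The relation then holds inside a bracket
  with any \<open>v\<close>, and the zero centre removes \<open>v\<close>.\<close>

lemma R_swap_right:
  assumes x: "homog L i x" and y: "homog L j y" and z: "homog L l z" and w: "homog L h w"
  shows "R y x w d e f z = psign (i * h + k * h) (R y w x d f e z)"
proof -
  let ?m = "Q (d + f) (br d y w) x" and ?n = "Q (d + e) (br d y x) w"
  have m: "homog L ((((j + h) mod 2) + i + k) mod 2) ?m" and n: "homog L ((((j + i) mod 2) + h + k) mod 2) ?n"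
    using x y w by (simp_all add: homog_Q homog_br)
  have "br (d + e + f) ?n z - psign (i * h + k * h) (br (d + e + f) ?m z) = 0"
  proof (rule center_right[OF center])
    fix a v and g :: complex assume v: "homog L a v"
    \<comment> \<open>\<open>two_expansions\<close> holds for every \<open>c\<close>, so
      \<open>c\<close> can be fitted to the arbitrary \<open>g\<close>. The bracket with
      \<open>v\<close> at \<open>g\<close> makes \<open>\<partial>\<close> a number, as
      \<open>flip_left\<close> requires for turning the inner brackets round.\<close>
    define c where "c = g - (d + e + f)"
    have g: "g = d + e + f + c" "g = (d + f) + (c + e)" by (simp_all add: c_def)
    define M N where "M = br g (br (d + e + f) ?m z) v" and "N = br g (br (d + e + f) ?n z) v"
    note neg = lin_minus[OF lin_br_left] lin_minus[OF lin_br_right] br_psign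
    have M: "br g (br c z ?m) v = - psign (l * ((((j + h) mod 2) + i + k) mod 2)) M"
      unfolding g(1) M_def by (rule flip_left[OF conf_bilin_lbr z m])
    have N: "br g (br c z ?n) v = - psign (l * ((((j + i) mod 2) + h + k) mod 2)) N"
      unfolding g(1) N_def by (rule flip_left[OF conf_bilin_lbr z n])
    have "br g (br (c + e) (Q c z x) (br d y w)) v
        = - psign ((l + i + k) mod 2 * ((j + h) mod 2)) (br g (br (d + f) (br d y w) (Q c z x)) v)"
      unfolding g(2) by (rule flip_left[OF conf_bilin_lbr homog_Q[OF z x] homog_br[OF y w]])
    also have "br g (br (d + f) (br d y w) (Q c z x)) v = - psign ((j + h) mod 2 * l) (br g (br c z ?m) v)"
      unfolding exchange[OF x homog_br[OF y w] z] neg ..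
    finally have first: "br g (br (c + e) (Q c z x) (br d y w)) v
        = psign ((l + i + k) mod 2 * ((j + h) mod 2)) (psign ((j + h) mod 2 * l)
            (- psign (l * ((((j + h) mod 2) + i + k) mod 2)) M))"
      unfolding M by (simp add: psign_def)
    have second: "br g (br (d + e) (br d y x) (Q c z w)) v
        = psign ((j + i) mod 2 * l) (psign (l * ((((j + i) mod 2) + h + k) mod 2)) N)"
      unfolding exchange[OF w homog_br[OF y x] z] neg N by (simp add: psign_def)
    have "psign (j * (l + i + k)) (br g (br (c + e) (Q c z x) (br d y w)) v)
        + psign (l * i) (br g (br (d + e) (br d y x) (Q c z w)) v) = br g 0 v"
      unfolding two_expansions[OF x y z w, of c d e, symmetric] lin_add[OF lin_br_left] neg ..
    then have "N - psign (i * h + k * h) M = 0"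
      unfolding first second 
      by (auto simp: psign_def algebra_simps neg_eq_iff_add_eq_0 eq_neg_iff_add_eq_0 split: if_splits)
    then show "br g (br (d + e + f) ?n z - psign (i * h + k * h) (br (d + e + f) ?m z)) v = 0"
      unfolding M_def N_def lin_diff[OF lin_br_left] neg .
  qed
  then show ?thesis by (simp add: add.assoc add.commute[of e f])
qed

lemma R_swap_left:
  assumes "homog L i x" "homog L j y"
  shows "R y x w d e f z = - psign (i * j) (R x y w e d f z)"
proof -
  have "Q (d + e) (br d y x) w = - psign (i * j) (Q (e + d) (br e x y) w)"
    using flip_left[OF conf_bilin_q assms(2,1), where c = e and d = d and x = w]
    by (simp only: add.commute[of d e] mult.commute[of j i])
  then show ?thesis
    by (simp only: lin_minus[OF lin_br_left] br_psign add.commute[of d e])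
qed

text \<open>The sign in \<open>R_swap_right\<close> is not symmetric in \<open>i\<close> and
  \<open>h\<close>: swapping twice restores the order but yields the sign of
  \<open>k * (i + h)\<close>.\<close>

lemma R_mismatch:
  assumes "homog L i x" "homog L j y" "homog L l z" "homog L h w" and "odd (k * (i + h))"
  shows "R y x w d e f z = 0"
proof (rule double_zero)
  have "R y x w d e f z = psign (i * h + k * h) (R y w x d f e z)"
    by (rule R_swap_right[OF assms(1-4)])
  also have "R y w x d f e z = psign (h * i + k * i) (R y x w d e f z)"
    by (rule R_swap_right[OF assms(4,2,3,1)])
  finally show "R y x w d e f z = - R y x w d e f z"
    unfolding psign_psign using assms(5) by (auto simp: psign_def split: if_splits)
qed

text \<open>The trilinear form R is, up to signs, antisymmetric in its first two and symmetric in its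
  last two arguments.  The signs spoil the resulting contradiction only for odd forms
  evaluated at three odd elements.\<close>
lemma R_zero:
  assumes x: "homog L i x" and y: "homog L j y" and z: "homog L l z" and w: "homog L h w"
    and par: "even (k * (i + j + h)) \<or> odd (k * (i + h)) \<or> odd (k * (j + h))"
  shows "R y x w d e f z = 0"
proof -
  consider "odd (k * (i + h))" | "odd (k * (j + h))" | "even (k * (i + j + h))" using par by blast
  then show ?thesis
  proof cases
    case 1 then show ?thesis by (rule R_mismatch[OF x y z w])
  next
    case 2
    have "R x y w e d f z = 0" by (rule R_mismatch[OF y x z w 2])
    then show ?thesis
      using R_swap_left[OF x y, where w = w and d = d and e = e and f = f and z = z] by simp
  next
    case 3
    \<comment> \<open>Six alternating swaps restore the order. The products of parities cancel in
      pairs; three minus signs and the sign of \<open>k * (i + j + h)\<close> remain.\<close>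
    note right = R_swap_right[OF _ _ z] and left = R_swap_left
    have "R y x w d e f z = psign (i * h + k * h) (R y w x d f e z)" by (rule right[OF x y w])
    also have "R y w x d f e z = - psign (h * j) (R w y x f d e z)" by (rule left[OF w y])
    also have "R w y x f d e z = psign (j * i + k * i) (R w x y f e d z)" by (rule right[OF y w x])
    also have "R w x y f e d z = - psign (i * h) (R x w y e f d z)" by (rule left[OF x w])
    also have "R x w y e f d z = psign (h * j + k * j) (R x y w e d f z)" by (rule right[OF w x y])
    also have "R x y w e d f z = - psign (j * i) (R y x w d e f z)" by (rule left[OF y x])
    finally have "R y x w d e f z = - R y x w d e f z"
      using 3 by (auto simp: psign_def split: if_splits)
    then show ?thesis by (rule double_zero)
  qed
qed

lemma q_zero_of_Leibniz: "q y x = 0"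
proof (rule q_zeroI)
  have generic: "Q (e + d) (br d y x) w = 0"
    if "homog L h w" "homog L j y" "homog L i x"
      "even (k * (i + j + h)) \<or> odd (k * (i + h)) \<or> odd (k * (j + h))" for i j h x y w d e
  proof (rule center_right[OF center])
    fix l z and g :: complex assume z: "homog L l z"
    from R_zero[OF that(3,2) z that(1,4), of d e "g - (d + e)"]
    show "br g (Q (e + d) (br d y x) w) z = 0" by (simp add: add.commute)
  qed
  fix h j i w y x and d e :: complex
  assume w: "homog L h w" and y: "homog L j y" and x: "homog L i x"
  show "Q (e + d) (br d y x) w = 0"
  proof (cases "even (k * (i + j + h)) \<or> odd (k * (i + h)) \<or> odd (k * (j + h))")
    case True
    with generic[OF w y x] show ?thesis .
  next
    case False
    show ?thesis
    proof (rule center_left[OF center homog_Q[OF homog_br[OF y x] w]])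
      fix l z and c :: complex assume z: "homog L l z"
      \<comment> \<open>Here \<open>k\<close>, \<open>x\<close>, \<open>y\<close> and
        \<open>w\<close> are odd. The bracket of \<open>y\<close> and \<open>x\<close> is even, so
        using it in place of \<open>x\<close> gives a parity mismatch with \<open>w\<close>,
        whatever the parity of \<open>z\<close>.\<close>
      have "Q (e + d + c) (br c z (br d y x)) w = 0"
        using False by (intro generic[OF w z homog_br[OF y x]]) auto
      then show "br c z (Q (e + d) (br d y x) w) = 0"
        using q_left[OF w z homog_br[OF y x]] by simp
    qed
  qed
qed

end

end

section \<open>Biderivations and the centroid\<close>

context lcsa
begin

section \<open>Closure properties and criteria\<close>

lemma pscal_add: "pscal L a (p + q) = pscal L a p + pscal L a q"
  and pscal_diff: "pscal L a (p - q) = pscal L a p - pscal L a q"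
  and pscal_pscal: "pscal L a (pscal L b p) = pscal L (a * b) p"
  and pscal_zero [simp]: "pscal L a 0 = 0"
  by (rule poly_eqI; simp add: coeff_pscal sc_add sc_diff sc_sc)+

lemma conf_bilin_diff:
  assumes "conf_bilin L k \<phi>" "conf_bilin L k \<psi>"
  shows "conf_bilin L k (\<lambda>x y. \<phi> x y - \<psi> x y)"
proof -
  have lin: "lin sc (pscal L) (\<lambda>x. \<phi> x y)" "lin sc (pscal L) (\<phi> x)"
    "lin sc (pscal L) (\<lambda>x. \<psi> x y)" "lin sc (pscal L) (\<psi> x)" for x y
    using assms by (simp_all add: conf_bilin_def)
  have *: "lin sc (pscal L) (\<lambda>x. \<phi> x y - \<psi> x y)" "lin sc (pscal L) (\<lambda>y. \<phi> x y - \<psi> x y)" for x y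
    unfolding lin_def by (simp_all add: lin[THEN lin_add] lin[THEN lin_scale] pscal_diff)
  show ?thesis
    unfolding conf_bilin_def
    using assms by (auto simp: * conf_bilin_def pev_diff sc_diff lin_diff[OF lin_der] intro: homog_diff)
qed

lemma conf_bilin_scale:
  assumes "conf_bilin L k \<phi>"
  shows "conf_bilin L k (\<lambda>x y. pscal L a (\<phi> x y))"
proof -
  have lin: "lin sc (pscal L) (\<lambda>x. \<phi> x y)" "lin sc (pscal L) (\<phi> x)" for x y
    using assms by (simp_all add: conf_bilin_def)
  have *: "lin sc (pscal L) (\<lambda>x. pscal L a (\<phi> x y))" "lin sc (pscal L) (\<lambda>y. pscal L a (\<phi> x y))" for x y
    unfolding lin_def
    by (simp_all add: lin[THEN lin_add] lin[THEN lin_scale] pscal_add pscal_pscal mult.commute)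
  show ?thesis
    unfolding conf_bilin_def
    using assms by (auto simp: * conf_bilin_def pev_pscal sc_add sc_sc lin_scale[OF lin_der]
        coeff_pscal mult.commute intro: homog_sc)
qed

lemma conf_bilin_zero: "k < 2 \<Longrightarrow> conf_bilin L k (\<lambda>x y. 0)"
  by (simp add: conf_bilin_def lin_def lin_zero[OF lin_der] homog_zero)

lemma conf_bilin_sum:
  assumes "k < 2" "\<And>s. s \<in> S \<Longrightarrow> conf_bilin L k (\<phi> s)"
  shows "conf_bilin L k (\<lambda>x y. \<Sum>s\<in>S. \<phi> s x y)"
  using assms(2)
proof (induction S rule: infinite_finite_induct)
  case (insert s S)
  then have "conf_bilin L k (\<phi> s)" "conf_bilin L k (\<lambda>x y. \<Sum>s\<in>S. \<phi> s x y)" by auto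
  from conf_bilin_diff[OF this(1) conf_bilin_diff[OF conf_bilin_zero[OF assms(1)] this(2)]]
  show ?case using insert.hyps by simp
qed (simp_all add: conf_bilin_zero[OF assms(1)])

lemma super_biderivationI:
  assumes b: "conf_bilin L k \<phi>"
    and skew: "\<And>i j x y c. homog L i x \<Longrightarrow> homog L j y \<Longrightarrow>
          pev L (\<phi> x y) c = - psign (i * j) (pev_skew L (\<phi> y x) c)"
    and Leibniz: "\<And>i j l x y z c d. homog L i x \<Longrightarrow> homog L j y \<Longrightarrow> homog L l z \<Longrightarrow>
          pev L (\<phi> x (br d y z)) c
          = br (c + d) (pev L (\<phi> x y) c) z + psign (i * j) (br d y (pev L (\<phi> x z) c))"
  shows "super_biderivation L k \<phi>"
proof -
  have "pev L (\<phi> x (br d y z)) c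
      = br (c + d) (pev L (\<phi> x y) c) z + psign (i * j) (br d y (pev L (\<phi> x z) c))"
    if "homog L i x" "homog L j y" for i j x y z c d
  proof -
    note lins = lin_pev_right[OF b] lin_br_right
    have "lin sc sc (\<lambda>z. pev L (\<phi> x (br d y z)) c
        - (br (c + d) (pev L (\<phi> x y) c) z + psign (i * j) (br d y (pev L (\<phi> x z) c))))"
      unfolding lin_def by (simp add: lins[THEN lin_add] lins[THEN lin_scale] sc_add sc_diff psign_def sc_minus)
    from lin_eq_zero[OF this] Leibniz[OF that] show ?thesis
      by (metis eq_iff_diff_eq_0)
  qed
  then show ?thesis using b skew unfolding super_biderivation_def by blast
qed

lemma super_biderivationD:
  assumes "super_biderivation L k \<phi>"
  shows "conf_bilin L k \<phi>"
    and "homog L i x \<Longrightarrow> homog L j y \<Longrightarrow>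
          pev L (\<phi> x y) c = - psign (i * j) (pev_skew L (\<phi> y x) c)"
    and "homog L i x \<Longrightarrow> homog L j y \<Longrightarrow> pev L (\<phi> x (br d y z)) c
          = br (c + d) (pev L (\<phi> x y) c) z + psign (i * j) (br d y (pev L (\<phi> x z) c))"
  using assms unfolding super_biderivation_def by blast+

lemma centroidD:
  assumes "centroid L k \<alpha>"
  shows "k < 2" "lin sc (pscal L) \<alpha>"
    and "homog L i x \<Longrightarrow> homog L ((i + k) mod 2) (coeff (\<alpha> x) n)"
    and "homog L i x \<Longrightarrow> pev L (\<alpha> (br d x y)) c = psign (i * k) (br d x (pev L (\<alpha> y) c))"
    and "homog L i x \<Longrightarrow> pev L (\<alpha> (br d x y)) c = br d (pev L (\<alpha> x) c) y"
  using assms unfolding centroid_def by blast+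

text \<open>The grading automorphism. The choice is unambiguous because the even and odd parts meet
  only in zero.\<close>

definition parity where
  "parity x = (SOME w. \<exists>u v. homog L 0 u \<and> homog L 1 v \<and> x = u + v \<and> w = u - v)"

lemma parity_eq: "homog L 0 u \<Longrightarrow> homog L 1 v \<Longrightarrow> parity (u + v) = u - v"
proof -
  assume h: "homog L 0 u" "homog L 1 v"
  then have "\<exists>w u' v'. homog L 0 u' \<and> homog L 1 v' \<and> u + v = u' + v' \<and> w = u' - v'" by blast
  from someI_ex[OF this] obtain u' v'
    where h': "homog L 0 u'" "homog L 1 v'" "u + v = u' + v'" "parity (u + v) = u' - v'"
    unfolding parity_def by auto
  have eq: "u - u' = v' - v" using h'(3) by (simp add: algebra_simps)
  have "homog L 0 (u - u')" by (rule homog_diff[OF h(1) h'(1)])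
  moreover have "homog L 1 (u - u')" unfolding eq by (rule homog_diff[OF h'(2) h(2)])
  ultimately have "u - u' = 0" by (rule homog_disjoint) simp
  with eq h'(4) show ?thesis by simp
qed

lemma parity_homog: "homog L i x \<Longrightarrow> parity x = psign i x"
  using parity_eq[of x 0] parity_eq[of 0 x] homog_cases[of i x] homog_zero[of 0] homog_zero[of 1]
  by (auto simp: psign_def)

lemma lin_parity: "lin sc sc parity"
proof -
  have "parity (x + y) = parity x + parity y" for x y
  proof -
    obtain u v where x: "homog L 0 u" "homog L 1 v" "x = u + v" by (rule homog_decomp)
    obtain u' v' where y: "homog L 0 u'" "homog L 1 v'" "y = u' + v'" by (rule homog_decomp)
    have "parity (u + u' + (v + v')) = u + u' - (v + v')"
      by (intro parity_eq homog_add x y)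
    then show ?thesis using x y by (simp add: parity_eq algebra_simps)
  qed
  moreover have "parity (sc a x) = sc a (parity x)" for a x
  proof -
    obtain u v where x: "homog L 0 u" "homog L 1 v" "x = u + v" by (rule homog_decomp)
    have "parity (sc a u + sc a v) = sc a u - sc a v"
      by (intro parity_eq homog_sc x)
    then show ?thesis using x by (simp add: parity_eq sc_add sc_diff)
  qed
  ultimately show ?thesis by (simp add: lin_def)
qed

lemma parity_der: "parity (der L x) = der L (parity x)"
proof -
  obtain u v where x: "homog L 0 u" "homog L 1 v" "x = u + v" by (rule homog_decomp)
  have "parity (der L u + der L v) = der L u - der L v"
    by (intro parity_eq homog_der x)
  then show ?thesis using x by (simp add: parity_eq lin_add[OF lin_der] lin_diff[OF lin_der])
qed

lemma homog_parity: "homog L i x \<Longrightarrow> homog L i (parity x)"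
  by (simp add: parity_homog homog_psign)

lemma conf_bilin_parity:
  assumes "conf_bilin L k \<psi>"
  shows "conf_bilin L k (\<lambda>x y. \<psi> (parity x) (parity y))"
proof -
  have lin: "lin sc (pscal L) (\<lambda>x. \<psi> x y)" "lin sc (pscal L) (\<psi> x)" for x y
    using assms by (simp_all add: conf_bilin_def)
  have "lin sc (pscal L) (\<lambda>x. \<psi> (parity x) (parity y))"
    "lin sc (pscal L) (\<lambda>y. \<psi> (parity x) (parity y))" for x y
    unfolding lin_def
    by (simp_all add: lin[THEN lin_add] lin[THEN lin_scale] lin_add[OF lin_parity] lin_scale[OF lin_parity])
  then show ?thesis
    using assms unfolding conf_bilin_def by (simp add: parity_der homog_parity)
qed

text \<open>The Leibniz rule in \<open>super_biderivation\<close> ignores the degree of \<open>\<psi>\<close>, whereas the centroid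
  relation does not; for an odd \<open>\<psi>\<close> and an odd y the two signs disagree.\<close>
lemma odd_biderivation_annihilated:
  assumes \<psi>: "super_biderivation L 1 \<psi>" and \<alpha>: "centroid L 1 \<alpha>"
    and eq: "\<And>x y c d. pev L (\<psi> x y) c = pev L (\<alpha> (br c x y)) d"
    and x: "homog L i x" and y: "homog L 1 y"
  shows "br d y (pev L (\<psi> x z) c) = 0"
proof -
  let ?A = "\<lambda>w. pev L (\<alpha> w) 0" and ?w = "br d y (pev L (\<psi> x z) c)"
  have lin: "lin sc sc ?A" by (rule lin_pev[OF centroidD(2)[OF \<alpha>]])
  have "?A (br (c + d) (br c x y) z) = br (c + d) (pev L (\<psi> x y) c) z"
    using centroidD(5)[OF \<alpha> homog_br[OF x y]] by (simp only: eq[of x y c 0])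
  moreover have "?A (br d y (br c x z)) = - ?w"
    using centroidD(4)[OF \<alpha> y, where d = d and c = 0] by (simp only: eq[of x z c 0]) (simp add: psign_def)
  moreover have "pev L (\<psi> x (br d y z)) c
      = ?A (br (c + d) (br c x y) z) + psign (i * 1) (?A (br d y (br c x z)))"
    unfolding eq[of x _ c 0] jacobi[OF x y] lin_add[OF lin] lin_psign[OF lin] ..
  ultimately have "psign i (- ?w) = psign i ?w"
    using super_biderivationD(3)[OF \<psi> x y, where d = d and z = z and c = c] by simp
  then have "?w = - ?w" by (auto simp: psign_def split: if_splits)
  then show ?thesis by (rule double_zero)
qed

text \<open>The twist multiplies the three terms of the Leibniz rule by the signs of
  \<open>i + j + l\<close>, \<open>i + j\<close> and \<open>i + l\<close>. The second disagrees with
  the first only for odd \<open>z\<close>, the third only for odd \<open>y\<close>, and then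
  \<open>odd_biderivation_annihilated\<close> makes the term in question zero.\<close>

lemma super_biderivation_parity:
  assumes \<psi>: "super_biderivation L 1 \<psi>" and \<alpha>: "centroid L 1 \<alpha>"
    and eq: "\<And>x y c d. pev L (\<psi> x y) c = pev L (\<alpha> (br c x y)) d"
  shows "super_biderivation L 1 (\<lambda>x y. \<psi> (parity x) (parity y))"
proof (rule super_biderivationI)
  note b = super_biderivationD(1)[OF \<psi>]
  have \<psi>_parity: "pev L (\<psi> (parity x) (parity y)) c = psign (i + j) (pev L (\<psi> x y) c)"
    "pev_skew L (\<psi> (parity x) (parity y)) c = psign (i + j) (pev_skew L (\<psi> x y) c)"
    if "homog L i x" "homog L j y" for i j x y c
  proof -
    have lin: "lin sc (pscal L) (\<lambda>x. \<psi> x y)" "lin sc (pscal L) (\<psi> x)" for x y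
      using b by (simp_all add: conf_bilin_def)
    have "\<psi> (parity x) (parity y) = psign (i + j) (\<psi> x y)"
      unfolding parity_homog[OF that(1)] parity_homog[OF that(2)] lin_psign[OF lin(1)] lin_psign[OF lin(2)]
      by (simp only: psign_psign add.commute)
    then show "pev L (\<psi> (parity x) (parity y)) c = psign (i + j) (pev L (\<psi> x y) c)"
      "pev_skew L (\<psi> (parity x) (parity y)) c = psign (i + j) (pev_skew L (\<psi> x y) c)"
      by (simp_all add: pev_psign pev_skew_psign)
  qed
  show "conf_bilin L 1 (\<lambda>x y. \<psi> (parity x) (parity y))" by (rule conf_bilin_parity[OF b])
  show "pev L (\<psi> (parity x) (parity y)) c = - psign (i * j) (pev_skew L (\<psi> (parity y) (parity x)) c)"
    if "homog L i x" "homog L j y" for i j x y c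
    unfolding \<psi>_parity(1)[OF that] \<psi>_parity(2)[OF that(2,1)] super_biderivationD(2)[OF \<psi> that]
    by (auto simp: psign_def)
  show "pev L (\<psi> (parity x) (parity (br d y z))) c
      = br (c + d) (pev L (\<psi> (parity x) (parity y)) c) z
        + psign (i * j) (br d y (pev L (\<psi> (parity x) (parity z)) c))"
    if x: "homog L i x" and y: "homog L j y" and z: "homog L l z" for i j l x y z c d
  proof -
    define U V where "U = br (c + d) (pev L (\<psi> x y) c) z" and "V = br d y (pev L (\<psi> x z) c)"
    have "U = 0" if "odd l"
    proof -
      have l: "homog L 1 z" using z that homog_cases[OF z] by auto
      have "lbr L z (pev L (\<psi> x y) c) = 0"
        by (rule pev_inject) (simp add: odd_biderivation_annihilated[OF \<psi> \<alpha> eq x l])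
      then show ?thesis
        unfolding U_def br_skew[OF pev_homog[OF b x y] z] by simp
    qed
    moreover have "V = 0" if "odd j"
    proof -
      have "homog L 1 y" using y that homog_cases[OF y] by auto
      then show ?thesis unfolding V_def by (rule odd_biderivation_annihilated[OF \<psi> \<alpha> eq x])
    qed
    moreover have "pev L (\<psi> (parity x) (parity (br d y z))) c
        = psign (i + (j + l) mod 2) (U + psign (i * j) V)"
      unfolding \<psi>_parity(1)[OF x homog_br[OF y z]] super_biderivationD(3)[OF \<psi> x y] U_def V_def ..
    moreover have "br (c + d) (pev L (\<psi> (parity x) (parity y)) c) z = psign (i + j) U"
      unfolding \<psi>_parity(1)[OF x y] br_psign U_def ..
    moreover have "br d y (pev L (\<psi> (parity x) (parity z)) c) = psign (i + l) V"
      unfolding \<psi>_parity(1)[OF x z] br_psign V_def ..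
    ultimately show ?thesis by (auto simp: psign_def)
  qed
qed

lemma centroid_zero: "k < 2 \<Longrightarrow> centroid L k (\<lambda>x. 0)"
  by (simp add: centroid_def lin_def homog_zero)

text \<open>If the degrees differ, the values of \<psi> are homogeneous of both parities, hence
  zero, and the zero map serves as \<open>\<alpha>'\<close>.\<close>

lemma centroid_same_degree:
  assumes b: "conf_bilin L k \<psi>" and \<alpha>: "centroid L k' \<alpha>"
    and eq: "\<And>x y c d. pev L (\<psi> x y) c = pev L (\<alpha> (br c x y)) d"
  obtains \<alpha>' where "centroid L k \<alpha>'" "\<And>x y c d. pev L (\<psi> x y) c = pev L (\<alpha>' (br c x y)) d"
proof (cases "k = k'")
  case True
  with \<alpha> eq that show thesis by blast
next
  case False
  have k: "k < 2" using b by (simp add: conf_bilin_def)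
  have hom: "pev L (\<psi> x y) c = 0" if h: "homog L i x" "homog L j y" for i j x y c
  proof (rule homog_disjoint)
    show "homog L ((i + j + k) mod 2) (pev L (\<psi> x y) c)" by (rule pev_homog[OF b h])
    show "homog L (((i + j) mod 2 + k') mod 2) (pev L (\<psi> x y) c)"
      unfolding eq[of x y c 0]
      by (intro homog_pev centroidD(3)[OF \<alpha>] homog_br h) simp
    show "(i + j + k) mod 2 \<noteq> ((i + j) mod 2 + k') mod 2"
      using False k centroidD(1)[OF \<alpha>] by (auto simp: less_2_cases_iff) presburger+
  qed
  have "pev L (\<psi> x y) c = 0" if "homog L i x" for i x y c
    by (rule lin_eq_zero[OF lin_pev_right[OF b] hom[OF that]])
  then have "pev L (\<psi> x y) c = 0" for x y c
    by (rule lin_eq_zero[OF lin_pev_left[OF b]])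
  then show thesis using that[OF centroid_zero[OF k]] by simp
qed

text \<open>In the odd case the sign is absorbed by twisting both arguments with the parity
  automorphism: this yields another biderivation, to which the hypothesis applies again.\<close>
lemma biderivation_twisted_centroid:
  assumes hyp: "\<And>k \<psi>. super_biderivation L k \<psi> \<Longrightarrow>
      \<exists>k' \<alpha>. centroid L k' \<alpha> \<and> (\<forall>x y c d. pev L (\<psi> x y) c = pev L (\<alpha> (br c x y)) d)"
    and \<psi>: "super_biderivation L k \<psi>"
  shows "\<exists>\<alpha>. centroid L k \<alpha> \<and> (\<forall>i j x y c d. homog L i x \<longrightarrow> homog L j y \<longrightarrow>
      pev L (\<psi> x y) c = psign (k * (i + j)) (pev L (\<alpha> (br c x y)) d))"
proof -
  have rep: thesis if "super_biderivation L k \<chi>"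
    and "\<And>\<alpha>. centroid L k \<alpha> \<Longrightarrow> (\<And>x y c d. pev L (\<chi> x y) c = pev L (\<alpha> (br c x y)) d) \<Longrightarrow> thesis"
    for \<chi> thesis
    using hyp[OF that(1)] centroid_same_degree[OF super_biderivationD(1)[OF that(1)]] that(2) by metis
  have "k < 2" using super_biderivationD(1)[OF \<psi>] by (simp add: conf_bilin_def)
  then consider "k = 0" | "k = 1" by linarith
  then show ?thesis
  proof cases
    case 1
    from rep[OF \<psi>] obtain \<alpha> where "centroid L k \<alpha>"
      "\<And>x y c d. pev L (\<psi> x y) c = pev L (\<alpha> (br c x y)) d" by blast
    with 1 show ?thesis by (intro exI[of _ \<alpha>]) (simp add: psign_def)
  next
    case 2
    \<comment> \<open>This \<alpha> only certifies that the twisted form is a biderivation; the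
      witness is the \<open>\<alpha>'\<close> belonging to the twist.\<close>
    from rep[OF \<psi>] obtain \<alpha> where "centroid L k \<alpha>"
      and eq: "\<And>x y c d. pev L (\<psi> x y) c = pev L (\<alpha> (br c x y)) d" by blast
    then have "super_biderivation L 1 (\<lambda>x y. \<psi> (parity x) (parity y))"
      using \<psi> 2 super_biderivation_parity by blast
    from rep[unfolded 2, OF this] obtain \<alpha>' where \<alpha>': "centroid L 1 \<alpha>'"
      and eq': "\<And>x y c d. pev L (\<psi> (parity x) (parity y)) c = pev L (\<alpha>' (br c x y)) d" by blast
    have "pev L (\<psi> x y) c = psign (k * (i + j)) (pev L (\<alpha>' (br c x y)) d)"
      if "homog L i x" "homog L j y" for i j x y c d
    proof -
      note b = super_biderivationD(1)[OF \<psi>]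
      have "pev L (\<alpha>' (br c x y)) d = psign j (psign i (pev L (\<psi> x y) c))"
        unfolding eq'[symmetric] parity_homog[OF that(1)] parity_homog[OF that(2)]
          lin_psign[OF lin_pev_left[OF b]] lin_psign[OF lin_pev_right[OF b]] ..
      then show ?thesis using 2 by (auto simp: psign_def)
    qed
    with \<alpha>' 2 show ?thesis by blast
  qed
qed

end

section \<open>The current superalgebra\<close>

lemma sum_fun_apply: "(\<Sum>i\<in>I. f i) t = (\<Sum>i\<in>I. f i t)"
  by (induction I rule: infinite_finite_induct) simp_all

lemma psign_apply: "psign k f t = psign k (f t)"
  by (simp add: psign_def)

abbreviation coord :: "'i \<Rightarrow> ('i \<Rightarrow> 'a::zero) poly \<Rightarrow> 'a poly" where
  "coord t \<equiv> map_poly (\<lambda>f. f t)"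

lemma coeff_coord: "coeff (coord t P) n = coeff P n t"
  by (simp add: coeff_map_poly)

lemma degree_coord_le: "degree (coord t P) \<le> degree P"
  by (rule degree_le) (simp add: coeff_coord coeff_eq_0)

locale current_lcsa = lcsa L for L :: "'a::ab_group_add lcs" +
  fixes m :: "('i::finite \<Rightarrow> complex) \<Rightarrow> ('i \<Rightarrow> complex) \<Rightarrow> ('i \<Rightarrow> complex)"
    and u :: "'i \<Rightarrow> complex"
  assumes comm_alg: "comm_alg m" and unit: "m u a = a"
begin

abbreviation C where "C \<equiv> current L m"
abbreviation e where "e \<equiv> basisv"

section \<open>Structure constants of the algebra\<close>

lemma m_comm: "m a b = m b a"
  and m_assoc: "m (m a b) c = m a (m b c)"
  and m_add: "m (a + b) c = m a c + m b c"
  and m_scale: "m (\<lambda>i. s * a i) b = (\<lambda>i. s * m a b i)"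
  using comm_alg unfolding comm_alg_def by blast+

lemma m_left_comm: "m a (m b c) = m b (m a c)"
  by (metis m_assoc m_comm)

lemma m_zero: "m 0 b = 0"
  using m_add[of 0 0 b] by simp

lemma m_expand: "m a b t = (\<Sum>i\<in>UNIV. a i * m (e i) b t)"
proof -
  have "m (\<Sum>i\<in>I. (\<lambda>t. a i * e i t)) b = (\<Sum>i\<in>I. (\<lambda>t. a i * m (e i) b t))" for I
    by (induction I rule: infinite_finite_induct)
      (simp_all only: simp_thms sum.infinite sum.empty sum.insert m_zero m_add m_scale)
  moreover have "(\<Sum>i\<in>UNIV. (\<lambda>t. a i * e i t)) = a"
  proof
    fix t
    have "a i * e i t = (if i = t then a t else 0)" for i
      by (simp add: basisv_def)
    then show "(\<Sum>i\<in>UNIV. (\<lambda>t. a i * e i t)) t = a t"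
      unfolding sum_fun_apply by simp
  qed
  ultimately have "m a b = (\<Sum>i\<in>UNIV. (\<lambda>t. a i * m (e i) b t))" by metis
  then show ?thesis by (simp only: sum_fun_apply)
qed

lemma sum_unit: "(\<Sum>s\<in>UNIV. sc (m (e s) u t) (W s)) = W t"
proof -
  have "sc (m (e s) u t) (W s) = (if s = t then W t else 0)" for s
    unfolding m_comm[of _ u] unit by (simp add: basisv_def)
  then show ?thesis by simp
qed

lemma sum_expand_left: "(\<Sum>i\<in>UNIV. sc (m (e i) b t * a i) w) = sc (m a b t) w"
  unfolding m_expand[of a b t] sc_sum_left by (simp add: mult.commute)

lemma sum_expand_right: "(\<Sum>i\<in>UNIV. sc (m b (e i) t * a i) w) = sc (m b a t) w"
  unfolding m_comm[of b] by (rule sum_expand_left)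

text \<open>Multiplication by \<open>a\<close> in coordinates. Contracting over \<open>v\<close>
  restores products in the algebra, to which associativity and commutativity apply.\<close>

lemma sum_collapse:
  "(\<Sum>v\<in>UNIV. sc (m a (e v) t) (\<Sum>s\<in>S. \<Sum>j\<in>J. sc (b s j v) (W s j)))
    = (\<Sum>s\<in>S. \<Sum>j\<in>J. sc (m a (b s j) t) (W s j))"
proof -
  have "(\<Sum>v\<in>UNIV. sc (m a (e v) t) (\<Sum>s\<in>S. \<Sum>j\<in>J. sc (b s j v) (W s j)))
      = (\<Sum>v\<in>UNIV. \<Sum>s\<in>S. \<Sum>j\<in>J. sc (m a (e v) t * b s j v) (W s j))"
    by (simp only: sc_sum sc_sc)
  also have "\<dots> = (\<Sum>s\<in>S. \<Sum>j\<in>J. \<Sum>v\<in>UNIV. sc (m a (e v) t * b s j v) (W s j))"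
    by (subst sum.swap) (rule sum.cong[OF refl], rule sum.swap)
  finally show ?thesis by (simp only: sum_expand_right)
qed

section \<open>Coordinates on the current superalgebra\<close>

lemma scal_current: "scal C c f t = sc c (f t)"
  and der_current: "der C f t = der L (f t)"
  by (simp_all add: current_def)

lemma homog_current: "homog C i f \<longleftrightarrow> (\<forall>t. homog L i (f t))"
  by (auto simp: homog_def current_def)

sublocale current: cvspace "current L m"
proof
  show "cvs (scal (current L m))"
    by (simp add: cvs_def current_def fun_eq_iff sc_add sc_add_left sc_sc)
qed

lemma pev_coord: "pev L (coord t P) c = pev C P c t"
  unfolding pev_upto[OF degree_coord_le] unfolding pev_def
  by (simp add: sum_fun_apply scal_current coeff_coord)

lemma pev_skew_coord: "pev_skew L (coord t P) c = pev_skew C P c t"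
proof -
  have "((\<lambda>v. scal C (- c) v - der C v) ^^ n) f t = (T c ^^ n) (f t)" for n f
    by (induction n) (simp_all add: scal_current der_current)
  then show ?thesis
    unfolding pev_skew_upto[OF degree_coord_le] unfolding pev_skew_def
    by (simp add: sum_fun_apply coeff_coord)
qed

lemma coord_add: "coord t (P + R) = coord t P + coord t R"
  and coord_pscal: "coord t (pscal C a P) = pscal L a (coord t P)"
  by (rule poly_eqI; simp add: coeff_coord coeff_pscal current.coeff_pscal scal_current)+

lemma tens_apply: "tens L x a t = sc (a t) x"
  by (simp add: tens_def)

lemma tens_add: "tens L (x + y) a = tens L x a + tens L y a"
  and tens_scale: "tens L (sc c x) a = scal C c (tens L x a)"
  and tens_der: "tens L (der L x) a = der C (tens L x a)"
  by (simp_all add: fun_eq_iff tens_apply scal_current der_current sc_add sc_sc mult.commute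
      lin_scale[OF lin_der])

lemma homog_tens: "homog L i x \<Longrightarrow> homog C i (tens L x a)"
  by (simp add: homog_current tens_apply homog_sc)

lemma coeff_tens_poly: "coeff (tens_poly L p a) n = tens L (coeff p n) a"
  unfolding tens_poly_def by (rule coeff_map_poly) (simp add: fun_eq_iff tens_apply)

lemma coord_tens_poly: "coord t (tens_poly L p a) = pscal L (a t) p"
  by (rule poly_eqI) (simp add: coeff_coord coeff_tens_poly tens_apply coeff_pscal)

lemma pev_tens_poly: "pev C (tens_poly L p a) c = tens L (pev L p c) a"
  by (rule ext) (simp add: pev_coord[symmetric] coord_tens_poly pev_pscal tens_apply)

lemma pev_lbr_current:
  "pev C (lbr C f g) c t = (\<Sum>i\<in>UNIV. \<Sum>j\<in>UNIV. sc (m (e i) (e j) t) (br c (f i) (g j)))"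
proof -
  have "lbr C f g = (\<Sum>i\<in>UNIV. \<Sum>j\<in>UNIV. tens_poly L (lbr L (f i) (g j)) (m (e i) (e j)))"
    by (simp add: current_def)
  then show ?thesis
    by (simp only: current.pev_sum sum_fun_apply pev_tens_poly tens_apply)
qed

lemma pev_lbr_tens_left:
  "pev C (lbr C (tens L y b) g) c t = (\<Sum>j\<in>UNIV. sc (m b (e j) t) (br c y (g j)))"
  unfolding pev_lbr_current tens_apply lin_scale[OF lin_br_left] sc_sc
  by (subst sum.swap) (simp only: sum_expand_left)

lemma pev_lbr_tens_right:
  "pev C (lbr C f (tens L z b)) c t = (\<Sum>i\<in>UNIV. sc (m (e i) b t) (br c (f i) z))"
  unfolding pev_lbr_current tens_apply lin_scale[OF lin_br_right] sc_sc
  by (simp only: sum_expand_right)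

lemma pev_lbr_tens: "pev C (lbr C (tens L y b) (tens L z b')) c = tens L (br c y z) (m b b')"
  by (rule ext) (simp only: pev_lbr_tens_left tens_apply lin_scale[OF lin_br_right] sc_sc sum_expand_right)

context
  fixes k \<phi>
  assumes \<phi>: "super_biderivation C k \<phi>"
begin

definition \<Phi> where "\<Phi> a b t x y = coord t (\<phi> (tens L x a) (tens L y b))"

lemma conf_bilin_\<Phi>: "conf_bilin L k (\<Phi> a b t)"
proof -
  have b: "conf_bilin C k \<phi>" using \<phi> by (simp add: super_biderivation_def)
  then have "lin (scal C) (pscal C) (\<lambda>x. \<phi> x y)" "lin (scal C) (pscal C) (\<phi> x)" for x y
    by (simp_all add: conf_bilin_def)
  note lin = this[THEN lin_add] this[THEN lin_scale]
  have "lin sc (pscal L) (\<lambda>x. \<Phi> a b t x y)" "lin sc (pscal L) (\<Phi> a b t x)" for x y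
    unfolding lin_def \<Phi>_def
    by (simp_all add: tens_add tens_scale lin coord_add coord_pscal)
  with b show ?thesis
    unfolding conf_bilin_def
    by (simp add: \<Phi>_def pev_coord tens_der scal_current der_current coeff_coord)
      (metis homog_tens homog_current)
qed

lemma \<Phi>_skew:
  assumes "homog L i x" "homog L j y"
  shows "pev L (\<Phi> a b t x y) c = - psign (i * j) (pev_skew L (\<Phi> b a t y x) c)"
proof -
  have "pev C (\<phi> (tens L x a) (tens L y b)) c
      = - psign (i * j) (pev_skew C (\<phi> (tens L y b) (tens L x a)) c)"
    using \<phi> homog_tens assms unfolding super_biderivation_def by blast
  then show ?thesis
    by (simp add: \<Phi>_def pev_coord pev_skew_coord psign_apply)
qed

text \<open>Attaching the unit to \<open>y\<close> and \<open>b\<close> to \<open>z\<close> makes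
  the inner bracket \<open>[y, z] \<otimes> b\<close>. Bracketing with \<open>y \<otimes> 1\<close>
  acts in each coordinate separately, while bracketing with \<open>z \<otimes> b\<close> mixes
  coordinates through multiplication by \<open>b\<close>.\<close>

lemma \<Phi>_Leibniz:
  assumes x: "homog L i x" and y: "homog L j y"
  shows "pev L (\<Phi> a b t x (br d y z)) c =
      (\<Sum>s\<in>UNIV. sc (m (e s) b t) (br (c + d) (pev L (\<Phi> a u s x y) c) z))
      + psign (i * j) (br d y (pev L (\<Phi> a b t x z) c))"
proof -
  let ?X = "tens L x a" and ?Y = "tens L y u" and ?Z = "tens L z b"
  have "pev C (\<phi> ?X (pev C (lbr C ?Y ?Z) d)) c = pev C (lbr C (pev C (\<phi> ?X ?Y) c) ?Z) (c + d)
      + psign (i * j) (pev C (lbr C ?Y (pev C (\<phi> ?X ?Z) c)) d)"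
    using \<phi> homog_tens[OF x] homog_tens[OF y] unfolding super_biderivation_def by blast
  from fun_cong[OF this[unfolded pev_lbr_tens unit], of t] show ?thesis
    unfolding \<Phi>_def pev_coord
    by (simp only: plus_fun_apply psign_apply pev_lbr_tens_left pev_lbr_tens_right m_comm[of u] sum_unit)
qed

lemma super_biderivation_\<Phi>_unit: "super_biderivation L k (\<Phi> u u t)"
  by (rule super_biderivationI) (simp_all add: conf_bilin_\<Phi> \<Phi>_skew \<Phi>_Leibniz sum_unit)

definition \<Psi> where "\<Psi> a t x y = (\<Sum>s\<in>UNIV. pscal L (m (e s) a t) (\<Phi> u u s x y))"

definition D where "D a b t x y = \<Phi> a b t x y - \<Psi> (m a b) t x y"

lemma pev_\<Psi>: "pev L (\<Psi> a t x y) c = (\<Sum>s\<in>UNIV. sc (m (e s) a t) (pev L (\<Phi> u u s x y) c))"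
  by (simp add: \<Psi>_def pev_sum pev_pscal)

text \<open>Associativity gives \<Psi> the same mixing of coordinates by \<open>b\<close> as in
  \<open>\<Phi>_Leibniz\<close>, so the difference \<open>D\<close> inherits that rule.\<close>

lemma \<Psi>_mult:
  "pev L (\<Psi> (m a b) t x y) c = (\<Sum>s\<in>UNIV. sc (m (e s) b t) (pev L (\<Psi> a s x y) c))"
proof -
  have "(\<Sum>s\<in>UNIV. sc (m (e s) b t) (pev L (\<Psi> a s x y) c))
      = (\<Sum>s\<in>UNIV. \<Sum>r\<in>UNIV. sc (m (e s) b t * m (e r) a s) (pev L (\<Phi> u u r x y) c))"
    unfolding pev_\<Psi> sc_sum sc_sc ..
  also have "\<dots> = (\<Sum>r\<in>UNIV. sc (m (m (e r) a) b t) (pev L (\<Phi> u u r x y) c))"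
    by (subst sum.swap) (simp only: sum_expand_left)
  finally show ?thesis by (simp only: pev_\<Psi> m_assoc)
qed

lemma conf_bilin_\<Psi>: "conf_bilin L k (\<Psi> a t)"
proof -
  have "k < 2" using conf_bilin_\<Phi> by (simp add: conf_bilin_def)
  then show ?thesis unfolding \<Psi>_def
    by (intro conf_bilin_sum conf_bilin_scale conf_bilin_\<Phi>)
qed

lemma \<Psi>_skew:
  assumes "homog L i x" "homog L j y"
  shows "pev L (\<Psi> a t x y) c = - psign (i * j) (pev_skew L (\<Psi> a t y x) c)"
  unfolding pev_\<Psi> \<Phi>_skew[OF assms] unfolding \<Psi>_def
  by (simp add: pev_skew_sum pev_skew_pscal psign_def sc_minus sum_negf)

lemma \<Psi>_Leibniz:
  assumes x: "homog L i x" and y: "homog L j y"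
  shows "pev L (\<Psi> a t x (br d y z)) c = br (c + d) (pev L (\<Psi> a t x y) c) z
      + psign (i * j) (br d y (pev L (\<Psi> a t x z) c))"
  unfolding pev_\<Psi> \<Phi>_Leibniz[OF assms] sum_unit
  by (simp add: lin_sum[OF lin_br_left] lin_sum[OF lin_br_right] lin_scale[OF lin_br_left]
      lin_scale[OF lin_br_right] sc_add sum.distrib psign_def sc_minus sum_negf)

lemma conf_bilin_D: "conf_bilin L k (D a b t)"
  unfolding D_def by (intro conf_bilin_diff conf_bilin_\<Phi> conf_bilin_\<Psi>)

lemma D_skew:
  assumes "homog L i x" "homog L j y"
  shows "pev L (D a b t x y) c = - psign (i * j) (pev_skew L (D b a t y x) c)"
  unfolding D_def pev_diff \<Phi>_skew[OF assms] \<Psi>_skew[OF assms] m_comm[of b a]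
  by (simp add: pev_skew_diff psign_def)

lemma D_Leibniz:
  assumes x: "homog L i x" and y: "homog L j y"
  shows "pev L (D a b t x (br d y z)) c =
      (\<Sum>s\<in>UNIV. sc (m (e s) b t) (br (c + d) (pev L (D a u s x y) c) z))
      + psign (i * j) (br d y (pev L (D a b t x z) c))"
proof -
  have mu: "m a u = a" using unit m_comm by metis
  show ?thesis
    unfolding D_def pev_diff \<Phi>_Leibniz[OF assms] \<Psi>_Leibniz[OF assms] mu \<Psi>_mult[of a b t x y]
    by (simp add: lin_diff[OF lin_br_left] lin_diff[OF lin_br_right] lin_sum[OF lin_br_left]
        lin_scale[OF lin_br_left] sc_diff sum_subtractf psign_def)
qed

lemma D_unit_unit: "D u u t x y = 0"
proof (rule pev_inject)
  fix c
  show "pev L (D u u t x y) c = pev L 0 c"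
    by (simp add: D_def pev_diff unit pev_\<Psi> sum_unit)
qed

lemma D_unit:
  assumes center: "center_zero L" shows "D b u t x y = 0"
proof -
  interpret adjoint_linear_form L k "D b u t"
  proof
    show "center_zero L" by (rule center)
    show "conf_bilin L k (D b u t)" by (rule conf_bilin_D)
    show "pev L (D b u t (br d y z) x) (c + d) = br d y (pev L (D b u t z x) c)"
      if "homog L i x" "homog L j y" "homog L l z" for i j l x y z c d
      \<comment> \<open>The partner of \<open>D b u\<close> under skew-symmetry is
        \<open>D u b\<close>, whose first Leibniz term contains only values of
        \<open>D u u\<close>.\<close>
      by (rule transpose_Leibniz[OF that, where p = "D u b t"])
        (simp_all add: D_skew D_Leibniz[OF that(1,2)] D_unit_unit)
  qed
  show ?thesis
  proof (rule q_zero_of_Leibniz)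
    fix i j l x y z c d assume h: "homog L j y" "homog L i x" "homog L l z"
    show "pev L (D b u t y (br d x z)) c = br (c + d) (pev L (D b u t y x) c) z
        + psign (i * j) (br d x (pev L (D b u t y z) c))"
      unfolding D_Leibniz[OF h(1,2)] sum_unit by (simp add: mult.commute)
  qed
qed

lemma D_zero:
  assumes center: "center_zero L" shows "D a b t x y = 0"
proof -
  have right: "pev L (D a b t x (br d y z)) c = psign (i * j) (br d y (pev L (D a b t x z) c))"
    if "homog L i x" "homog L j y" for a b i j x y z c d
    unfolding D_Leibniz[OF that] D_unit[OF center] by simp
  interpret adjoint_linear_form L k "D a b t"
  proof
    show "center_zero L" by (rule center)
    show "conf_bilin L k (D a b t)" by (rule conf_bilin_D)
    show "pev L (D a b t (br d y z) x) (c + d) = br d y (pev L (D a b t z x) c)"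
      if "homog L i x" "homog L j y" "homog L l z" for i j l x y z c d
      by (rule transpose_Leibniz[OF that, where p = "D b a t"])
        (simp_all add: D_skew right[OF that(1,2)])
  qed
  show ?thesis
    by (rule q_zero_of_adjoint_linear_right) (simp add: right mult.commute)
qed

lemma pev_\<phi>_tens:
  assumes "center_zero L"
  shows "pev C (\<phi> (tens L x a) (tens L y b)) c t
    = (\<Sum>s\<in>UNIV. sc (m (e s) (m a b) t) (pev L (\<Phi> u u s x y) c))"
proof -
  have "\<Phi> a b t x y = \<Psi> (m a b) t x y"
    using D_zero[OF assms, of a b t x y] by (simp add: D_def)
  then show ?thesis unfolding pev_\<Psi>[symmetric] by (simp add: \<Phi>_def pev_coord[symmetric])
qed

end

text \<open>The linear extension of \<open>x \<otimes> a \<mapsto> \<Sum>s. \<alpha> s x \<otimes>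
  (e s) a\<close>, the candidate for \<epsilon>.\<close>

definition extend :: "('i \<Rightarrow> 'a \<Rightarrow> 'a poly) \<Rightarrow> ('i \<Rightarrow> 'a) \<Rightarrow> ('i \<Rightarrow> 'a) poly" where
  "extend \<alpha> f = (\<Sum>s\<in>UNIV. \<Sum>r\<in>UNIV. tens_poly L (\<alpha> s (f r)) (m (e s) (e r)))"

lemma coeff_extend:
  "coeff (extend \<alpha> f) n t = (\<Sum>s\<in>UNIV. \<Sum>r\<in>UNIV. sc (m (e s) (e r) t) (coeff (\<alpha> s (f r)) n))"
  by (simp add: extend_def coeff_sum sum_fun_apply coeff_tens_poly tens_apply)

lemma pev_extend:
  "pev C (extend \<alpha> f) c t = (\<Sum>s\<in>UNIV. \<Sum>r\<in>UNIV. sc (m (e s) (e r) t) (pev L (\<alpha> s (f r)) c))"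
  by (simp add: extend_def current.pev_sum sum_fun_apply pev_tens_poly tens_apply)

lemma pev_extend_tens:
  assumes "\<And>s. lin sc (pscal L) (\<alpha> s)"
  shows "pev C (extend \<alpha> (tens L x a)) c t = (\<Sum>s\<in>UNIV. sc (m (e s) a t) (pev L (\<alpha> s x) c))"
  unfolding pev_extend tens_apply lin_scale[OF lin_pev[OF assms]] sc_sc sum_expand_right ..

text \<open>All three sides of the centroid relation expand into the same values
  \<open>?W s i j\<close>. Their coefficients are products of the same three basis vectors in
  different orders, equal by associativity and commutativity.\<close>

lemma centroid_extend:
  assumes \<alpha>: "\<And>s. centroid L k (\<alpha> s)"
  shows "centroid C k (extend \<alpha>)"
proof -
  note deg = centroidD(1)[OF \<alpha>] and hom = centroidD(3)[OF \<alpha>]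
    and left = centroidD(4)[OF \<alpha>] and right = centroidD(5)[OF \<alpha>]
  note lin = centroidD(2)[OF \<alpha>, THEN lin_pev]
  have "extend \<alpha> (f + g) = extend \<alpha> f + extend \<alpha> g" for f g
    by (rule current.pev_inject, rule ext)
      (simp add: current.pev_add pev_extend lin_add[OF lin] sc_add sum.distrib)
  moreover have "extend \<alpha> (scal C a f) = pscal C a (extend \<alpha> f)" for a f
    by (rule current.pev_inject, rule ext)
      (simp add: current.pev_pscal pev_extend scal_current lin_scale[OF lin] sc_sc sc_sum mult.commute)
  ultimately have "lin (scal C) (pscal C) (extend \<alpha>)" by (simp only: lin_def simp_thms)
  moreover have "homog C ((i + k) mod 2) (coeff (extend \<alpha> f) n)" if "homog C i f" for i f n
    using that unfolding homog_current coeff_extend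
    by (intro allI homog_sum homog_sc hom) auto
  moreover have "pev C (extend \<alpha> (pev C (lbr C f g) d)) c
        = psign (i * k) (pev C (lbr C f (pev C (extend \<alpha> g) c)) d)"
      (is ?left)
    and "pev C (extend \<alpha> (pev C (lbr C f g) d)) c = pev C (lbr C (pev C (extend \<alpha> f) c) g) d"
      (is ?right)
    if f: "homog C i f" for i f g c d
  proof -
    have f: "homog L i (f t)" for t using f by (simp add: homog_current)
    let ?W = "\<lambda>s i j. pev L (\<alpha> s (br d (f i) (g j))) c"
    have ext: "pev C (extend \<alpha> (pev C (lbr C f g) d)) c t
        = (\<Sum>s\<in>UNIV. \<Sum>i\<in>UNIV. \<Sum>j\<in>UNIV. sc (m (e s) (m (e i) (e j)) t) (?W s i j))" for t
      unfolding pev_extend pev_lbr_current lin_sum[OF lin] lin_scale[OF lin] sum_collapse ..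
    show ?left
    proof
      fix t
      have W: "br d (f j) (pev L (\<alpha> s (g h)) c) = psign (i * k) (?W s j h)" for s j h
        unfolding left[OF f] psign_psign by (simp add: psign_def)
      have "psign (i * k) (pev C (lbr C f (pev C (extend \<alpha> g) c)) d) t
          = psign (i * k) (\<Sum>j\<in>UNIV. \<Sum>s\<in>UNIV. \<Sum>h\<in>UNIV.
              sc (m (e j) (m (e s) (e h)) t) (psign (i * k) (?W s j h)))"
        unfolding psign_apply pev_lbr_current pev_extend lin_sum[OF lin_br_right]
          lin_scale[OF lin_br_right] sum_collapse W ..
      also have "\<dots> = (\<Sum>j\<in>UNIV. \<Sum>s\<in>UNIV. \<Sum>h\<in>UNIV. sc (m (e j) (m (e s) (e h)) t) (?W s j h))"
        by (simp add: psign_def sc_minus sum_negf)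
      also have "\<dots> = (\<Sum>j\<in>UNIV. \<Sum>s\<in>UNIV. \<Sum>h\<in>UNIV. sc (m (e s) (m (e j) (e h)) t) (?W s j h))"
        by (intro sum.cong refl) (subst m_left_comm, rule refl)
      also have "\<dots> = (\<Sum>s\<in>UNIV. \<Sum>j\<in>UNIV. \<Sum>h\<in>UNIV. sc (m (e s) (m (e j) (e h)) t) (?W s j h))"
        by (rule sum.swap)
      finally show "pev C (extend \<alpha> (pev C (lbr C f g) d)) c t
          = psign (i * k) (pev C (lbr C f (pev C (extend \<alpha> g) c)) d) t"
        unfolding ext by simp
    qed
    show ?right
    proof
      fix t
      have "pev C (lbr C (pev C (extend \<alpha> f) c) g) d t
          = (\<Sum>j\<in>UNIV. \<Sum>v\<in>UNIV. sc (m (e j) (e v) t) (\<Sum>s\<in>UNIV. \<Sum>i\<in>UNIV.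
              sc (m (e s) (e i) v) (?W s i j)))"
        unfolding pev_lbr_current pev_extend lin_sum[OF lin_br_left]
          lin_scale[OF lin_br_left] right[OF f] by (subst sum.swap) (simp only: m_comm)
      also have "\<dots> = (\<Sum>j\<in>UNIV. \<Sum>s\<in>UNIV. \<Sum>i\<in>UNIV. sc (m (e j) (m (e s) (e i)) t) (?W s i j))"
        by (simp only: sum_collapse)
      also have "\<dots> = (\<Sum>s\<in>UNIV. \<Sum>j\<in>UNIV. \<Sum>i\<in>UNIV. sc (m (e j) (m (e s) (e i)) t) (?W s i j))"
        by (rule sum.swap)
      also have "\<dots> = (\<Sum>s\<in>UNIV. \<Sum>i\<in>UNIV. \<Sum>j\<in>UNIV. sc (m (e j) (m (e s) (e i)) t) (?W s i j))"
        by (rule sum.cong[OF refl], rule sum.swap)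
      also have "\<dots> = (\<Sum>s\<in>UNIV. \<Sum>i\<in>UNIV. \<Sum>j\<in>UNIV. sc (m (e s) (m (e i) (e j)) t) (?W s i j))"
        by (intro sum.cong refl) (subst m_left_comm, subst m_comm[of "e _" "e _"], rule refl)
      finally show "pev C (extend \<alpha> (pev C (lbr C f g) d)) c t
          = pev C (lbr C (pev C (extend \<alpha> f) c) g) d t"
        unfolding ext by simp
    qed
  qed
  ultimately show ?thesis
    unfolding centroid_def using deg by blast
qed

text \<open>The centroid elements chosen for the coordinates share the degree \<open>k\<close> and
  the sign of \<open>k * (i + j)\<close>, so the sign can be pulled out of the sum over
  \<open>s\<close>.\<close>

lemma biderivation_current:
  assumes \<phi>: "super_biderivation C k \<phi>" and center: "center_zero L"
    and hyp: "\<And>k \<psi>. super_biderivation L k \<psi> \<Longrightarrow>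
      \<exists>k' \<alpha>. centroid L k' \<alpha> \<and> (\<forall>x y c d. pev L (\<psi> x y) c = pev L (\<alpha> (br c x y)) d)"
  shows "\<exists>k' \<epsilon>. centroid C k' \<epsilon> \<and>
    (\<forall>i j x y a b c d. homog L i x \<longrightarrow> homog L j y \<longrightarrow>
       pev C (\<phi> (tens L x a) (tens L y b)) c
       = psign (k * (i + j)) (pev C (\<epsilon> (pev C (tens_poly L (lbr L x y) (m a b)) c)) d))"
proof -
  let ?P = "\<lambda>s \<alpha>. centroid L k \<alpha> \<and> (\<forall>i j x y c d. homog L i x \<longrightarrow> homog L j y \<longrightarrow>
      pev L (\<Phi> \<phi> u u s x y) c = psign (k * (i + j)) (pev L (\<alpha> (br c x y)) d))"
  have "\<exists>\<alpha>. ?P s \<alpha>" for s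
    by (rule biderivation_twisted_centroid[OF hyp super_biderivation_\<Phi>_unit[OF \<phi>]])
  then have "\<exists>\<alpha>. \<forall>s. ?P s (\<alpha> s)" by (intro choice allI)
  then obtain \<alpha> where P: "\<forall>s. ?P s (\<alpha> s)" ..
  have \<alpha>: "centroid L k (\<alpha> s)" for s using P by blast
  have rep: "pev L (\<Phi> \<phi> u u s x y) c = psign (k * (i + j)) (pev L (\<alpha> s (br c x y)) d)"
    if "homog L i x" "homog L j y" for s i j x y c d
    using P that by blast
  have "pev C (\<phi> (tens L x a) (tens L y b)) c
      = psign (k * (i + j)) (pev C (extend \<alpha> (pev C (tens_poly L (lbr L x y) (m a b)) c)) d)"
    if h: "homog L i x" "homog L j y" for i j x y a b c d
  proof
    fix t
    have "pev C (\<phi> (tens L x a) (tens L y b)) c t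
        = (\<Sum>s\<in>UNIV. sc (m (e s) (m a b) t) (psign (k * (i + j)) (pev L (\<alpha> s (br c x y)) d)))"
      unfolding pev_\<phi>_tens[OF \<phi> center] by (intro sum.cong refl arg_cong[where f = "sc _"] rep[OF h])
    also have "\<dots> = psign (k * (i + j)) (\<Sum>s\<in>UNIV. sc (m (e s) (m a b) t) (pev L (\<alpha> s (br c x y)) d))"
      by (simp add: psign_def sc_minus sum_negf)
    finally show "pev C (\<phi> (tens L x a) (tens L y b)) c t
        = psign (k * (i + j)) (pev C (extend \<alpha> (pev C (tens_poly L (lbr L x y) (m a b)) c)) d) t"
      unfolding psign_apply pev_tens_poly pev_extend_tens[OF centroidD(2)[OF \<alpha>]] .
  qed
  moreover have "centroid C k (extend \<alpha>)" by (rule centroid_extend) (rule \<alpha>)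
  ultimately show ?thesis by blast
qed

end

theorem mainTheorem6:
  fixes L :: "'a::ab_group_add lcs"
    and m :: "('i::finite \<Rightarrow> complex) \<Rightarrow> ('i \<Rightarrow> complex) \<Rightarrow> ('i \<Rightarrow> complex)"
  assumes "is_LCSA L"
    and "center_zero L"
    and "comm_alg m"
    and "\<forall>k \<psi>. super_biderivation L k \<psi> \<longrightarrow>
           (\<exists>k' \<alpha>. centroid L k' \<alpha> \<and>
              (\<forall>x y c d. pev L (\<psi> x y) c = pev L (\<alpha> (pev L (lbr L x y) c)) d))"
  shows "\<forall>k \<phi>. super_biderivation (current L m) k \<phi> \<longrightarrow>
           (\<exists>k' \<epsilon>. centroid (current L m) k' \<epsilon> \<and>
              (\<forall>i j x y a b c d. homog L i x \<longrightarrow> homog L j y \<longrightarrow>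
                 pev (current L m) (\<phi> (tens L x a) (tens L y b)) c
                 = psign (k * (i + j))
                     (pev (current L m) (\<epsilon> (pev (current L m) (tens_poly L (lbr L x y) (m a b)) c)) d)))"
proof -
  have "\<exists>u. \<forall>a. m u a = a" using assms(3) unfolding comm_alg_def by (elim conjE)
  then obtain u where u: "\<forall>a. m u a = a" ..
  have "lcsa L" by (rule lcsa.intro) (rule assms(1))
  moreover have "current_lcsa_axioms m u"
    by (rule current_lcsa_axioms.intro) (rule assms(3), rule u[rule_format])
  ultimately have "current_lcsa L m u" by (rule current_lcsa.intro)
  then interpret current_lcsa L m u .
  show ?thesis
    by (intro allI impI, rule biderivation_current[OF _ assms(2)])
      (assumption, rule assms(4)[rule_format])
qed

end
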